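(* Let $G=(\mathcal{V},\mathcal{E})$ be a finite simple graph with $|\mathcal{V}|=\ell$. The following are equivalent. (i) There is a bijection (labeling) $\mathcal{V}\to[\ell]$ such that, for the resulting labeled graph $G'=([\ell],\mathcal{E}')$, the set $\Psi(G')=\{\epsilon_i-\epsilon_j \mid \{i,j\}\in\mathcal{E}',\ i<j\}\subseteq\Phi^+(A_{\ell-1})$ is Worpitzky-compatible (i.e. the graphic arrangement $\mathcal{A}(G')$ is compatible). (ii) $G$ has an ordering $v_1<v_2<\cdots<v_\ell$ of its vertices such that whenever $i<j$, $\{v_i,v_j\}\in\mathcal{E}$ and $(p_1,\ldots,p_m)$ is any sequence of integers with $i=p_1<p_2<\cdots<p_m=j$, there exists $a$ with $1\le a<m$ such that $\{v_{p_a},v_{p_{a+1}}\}\in\mathcal{E}$. (iii) $G$ is a cocomparability graph.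
   Context: Root system of type $A_{\ell-1}$: let $\epsilon_1,\dots,\epsilon_\ell$ be the standard orthonormal basis of $\mathbb{R}^\ell$ with the standard inner product $(\cdot,\cdot)$, and $U=\{\sum r_i\epsilon_i \mid \sum r_i=0\}$. Positive roots: $\Phi^+(A_{\ell-1})=\{\epsilon_i-\epsilon_j\mid 1\le i<j\le\ell\}$; simple roots $\alpha_i=\epsilon_i-\epsilon_{i+1}$, $1\le i\le \ell-1$. For a root $\alpha$ and $m\in\mathbb{Z}$, $H_{\alpha,m}=\{x\in U\mid (\alpha,x)=m\}$. An alcove is a connected component of $U\setminus\bigcup_{\alpha\in\Phi^+,m\in\mathbb{Z}}H_{\alpha,m}$. The walls of an alcove $A$ are the hyperplanes $H_{\alpha,m}$ supporting a facet of $A$; the ceilings of $A$ are the walls not passing through the origin and having the origin on the same side as $A$. The upper closure $A^\diamondsuit$ is the union of $A$ and its facets supported by ceilings of $A$. The fundamental parallelepiped is $P^\diamondsuit=\{x\in U\mid 0<(\alpha_i,x)\le 1 \text{ for } 1\le i\le\ell-1\}$. A subset $\Psi\subseteq\Phi^+$ is Worpitzky-compatible if for every alcove $A\subseteq P^\diamondsuit$, every $\alpha\in\Psi$ and $m\in\mathbb{Z}$, the set $A^\diamondsuit\cap H_{\alpha,m}$ is either empty or contained in some ceiling $H_{\beta,m'}$ of $A$ with $\beta\in\Psi$, $m'\in\mathbb{Z}$. A graph is a comparability graph if its edges can be oriented transitively (if $u\to v$ and $v\to w$ then $u\to w$); it is a cocomparability graph if its complement is a comparability graph.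
   Formalization: In the upper closure, the facets supported by ceilings are taken half-open (points on walls that are not ceilings are removed), i.e. k < (α,x) ≤ k+1 for each positive root α; with closed or relatively open facets the equivalence with (i) is false. *)

theory Defs
  imports "HOL-Analysis.Analysis"
begin

section \<open>Finite simple graphs\<close>

definition all_pairs :: "'a set \<Rightarrow> 'a set set" where
  "all_pairs V = {e. e \<subseteq> V \<and> card e = 2}"

definition finite_simple_graph :: "'a set \<Rightarrow> 'a set set \<Rightarrow> bool" where
  "finite_simple_graph V E \<longleftrightarrow> finite V \<and> E \<subseteq> all_pairs V"

definition orientation :: "'a set set \<Rightarrow> ('a \<times> 'a) set \<Rightarrow> bool" where
  "orientation E R \<longleftrightarrow>
     (\<forall>u v. (u, v) \<in> R \<longrightarrow> {u, v} \<in> E) \<and>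
     (\<forall>u v. {u, v} \<in> E \<longrightarrow> ((u, v) \<in> R \<longleftrightarrow> (v, u) \<notin> R))"

definition comparability_graph :: "'a set \<Rightarrow> 'a set set \<Rightarrow> bool" where
  "comparability_graph V E \<longleftrightarrow>
     finite_simple_graph V E \<and> (\<exists>R. orientation E R \<and> trans R)"

definition cocomparability_graph :: "'a set \<Rightarrow> 'a set set \<Rightarrow> bool" where
  "cocomparability_graph V E \<longleftrightarrow>
     finite_simple_graph V E \<and> comparability_graph V (all_pairs V - E)"

section \<open>Roots, alcoves and ceilings in type A\<close>

text \<open>Throughout, \<open>\<epsilon> 1, \<dots>, \<epsilon> l\<close> is meant to enumerate the standard basis of the
  \<open>l\<close>-dimensional ambient Euclidean space; the values of \<open>\<epsilon>\<close> at other arguments are irrelevant.\<close>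

definition zero_sum_space :: "(nat \<Rightarrow> 'e::euclidean_space) \<Rightarrow> nat \<Rightarrow> 'e set" where
  "zero_sum_space \<epsilon> l =
     {(\<Sum>i=1..l. r i *\<^sub>R \<epsilon> i) | r :: nat \<Rightarrow> real. (\<Sum>i=1..l. r i) = 0}"

definition pos_roots :: "(nat \<Rightarrow> 'e::euclidean_space) \<Rightarrow> nat \<Rightarrow> 'e set" where
  "pos_roots \<epsilon> l = {\<epsilon> i - \<epsilon> j | i j. 1 \<le> i \<and> i < j \<and> j \<le> l}"

definition simple_root :: "(nat \<Rightarrow> 'e::euclidean_space) \<Rightarrow> nat \<Rightarrow> 'e" where
  "simple_root \<epsilon> i = \<epsilon> i - \<epsilon> (i + 1)"

definition aff_hyperplane ::
    "(nat \<Rightarrow> 'e::euclidean_space) \<Rightarrow> nat \<Rightarrow> 'e \<Rightarrow> int \<Rightarrow> 'e set" where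
  "aff_hyperplane \<epsilon> l \<alpha> m = {x \<in> zero_sum_space \<epsilon> l. \<alpha> \<bullet> x = of_int m}"

definition alcoves :: "(nat \<Rightarrow> 'e::euclidean_space) \<Rightarrow> nat \<Rightarrow> 'e set set" where
  "alcoves \<epsilon> l =
     components (zero_sum_space \<epsilon> l - (\<Union>\<alpha>\<in>pos_roots \<epsilon> l. \<Union>m. aff_hyperplane \<epsilon> l \<alpha> m))"

text \<open>The facets of an alcove are those of its closure, a polytope. An \<open>aff_hyperplane\<close> never meets
  the open alcove, so it supports a facet iff it cuts the closure in one.\<close>

definition walls :: "(nat \<Rightarrow> 'e::euclidean_space) \<Rightarrow> nat \<Rightarrow> 'e set \<Rightarrow> 'e set set" where
  "walls \<epsilon> l A =
     {aff_hyperplane \<epsilon> l \<alpha> m | \<alpha> m.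
        \<alpha> \<in> pos_roots \<epsilon> l \<and> (closure A \<inter> aff_hyperplane \<epsilon> l \<alpha> m) facet_of closure A}"

definition ceilings :: "(nat \<Rightarrow> 'e::euclidean_space) \<Rightarrow> nat \<Rightarrow> 'e set \<Rightarrow> 'e set set" where
  "ceilings \<epsilon> l A =
     {aff_hyperplane \<epsilon> l \<alpha> m | \<alpha> m.
        \<alpha> \<in> pos_roots \<epsilon> l \<and> aff_hyperplane \<epsilon> l \<alpha> m \<in> walls \<epsilon> l A \<and>
        0 \<notin> aff_hyperplane \<epsilon> l \<alpha> m \<and>
        (\<forall>x\<in>A. \<alpha> \<bullet> x < of_int m \<longleftrightarrow> \<alpha> \<bullet> 0 < of_int m)}"

text \<open>The facets adjoined to form the upper closure are half-open: points lying on a wall that is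
  not a ceiling are left out. This is the convention under which the upper closures of the alcoves
  in the fundamental parallelepiped partition it (the Worpitzky partition): if \<open>A\<close> is the alcove
  given by \<open>k\<^sub>\<alpha> < \<alpha> \<bullet> x < k\<^sub>\<alpha> + 1\<close> for all positive roots \<open>\<alpha>\<close>, with all \<open>k\<^sub>\<alpha> \<ge> 0\<close>,
  then its upper closure is given by \<open>k\<^sub>\<alpha> < \<alpha> \<bullet> x \<le> k\<^sub>\<alpha> + 1\<close>. Adjoining
  closed facets would make the upper closures overlap and leave the parallelepiped; adjoining only
  their relative interiors would miss the points lying on several ceilings.\<close>

definition upper_closure :: "(nat \<Rightarrow> 'e::euclidean_space) \<Rightarrow> nat \<Rightarrow> 'e set \<Rightarrow> 'e set" where
  "upper_closure \<epsilon> l A =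
     A \<union> (\<Union>H\<in>ceilings \<epsilon> l A. (closure A \<inter> H) - \<Union>(walls \<epsilon> l A - ceilings \<epsilon> l A))"

definition fundamental_parallelepiped ::
    "(nat \<Rightarrow> 'e::euclidean_space) \<Rightarrow> nat \<Rightarrow> 'e set" where
  "fundamental_parallelepiped \<epsilon> l =
     {x \<in> zero_sum_space \<epsilon> l.
        \<forall>i. 1 \<le> i \<and> i < l \<longrightarrow> 0 < simple_root \<epsilon> i \<bullet> x \<and> simple_root \<epsilon> i \<bullet> x \<le> 1}"

definition worpitzky_compatible ::
    "(nat \<Rightarrow> 'e::euclidean_space) \<Rightarrow> nat \<Rightarrow> 'e set \<Rightarrow> bool" where
  "worpitzky_compatible \<epsilon> l \<Psi> \<longleftrightarrow>
     \<Psi> \<subseteq> pos_roots \<epsilon> l \<and>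
     (\<forall>A\<in>alcoves \<epsilon> l. A \<subseteq> fundamental_parallelepiped \<epsilon> l \<longrightarrow>
        (\<forall>\<alpha>\<in>\<Psi>. \<forall>m::int.
           upper_closure \<epsilon> l A \<inter> aff_hyperplane \<epsilon> l \<alpha> m = {} \<or>
           (\<exists>\<beta>\<in>\<Psi>. \<exists>m'::int. aff_hyperplane \<epsilon> l \<beta> m' \<in> ceilings \<epsilon> l A \<and>
              upper_closure \<epsilon> l A \<inter> aff_hyperplane \<epsilon> l \<alpha> m \<subseteq> aff_hyperplane \<epsilon> l \<beta> m')))"

definition graph_roots :: "(nat \<Rightarrow> 'e::euclidean_space) \<Rightarrow> nat set set \<Rightarrow> 'e set" where
  "graph_roots \<epsilon> E = {\<epsilon> i - \<epsilon> j | i j. {i, j} \<in> E \<and> i < j}"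

end

theory Submission
  imports Defs
begin

text \<open>Conditions (ii) and (iii) both amount to an ordering without umbrellas, i.e. without
  \<open>i < k < j\<close> such that \<open>{i, j}\<close> is an edge but \<open>{i, k}\<close> and \<open>{k, j}\<close> are not.

  For the geometry, write \<open>x\<^sub>p\<close> for \<open>\<epsilon> p \<bullet> x\<close> and fix a point \<open>a\<close> of an alcove. The alcove is given
  by the inequalities \<open>x\<^sub>p - x\<^sub>q > \<lfloor>a\<^sub>p - a\<^sub>q\<rfloor>\<close> for all ordered pairs \<open>p \<noteq> q\<close>. Arrange the coordinates
  of \<open>a\<close> modulo 1 on a circle, in decreasing order: the walls are the inequalities for the pairs that
  are consecutive on the circle, every other inequality being a sum of those along an arc. In the
  dominant chamber the ceilings are the walls of pairs with \<open>p > q\<close>. So a point of the upper closure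
  lies on \<open>H\<^bsub>\<epsilon> i - \<epsilon> j, m\<^esub>\<close>, \<open>i < j\<close>, only if the arc from \<open>j\<close> to \<open>i\<close> is a descending chain
  of ceilings, and compatibility says that one of the links of each such chain is an edge whenever
  \<open>{i, j}\<close> is. All descending chains occur, already for alcoves in the fundamental
  parallelepiped.\<close>

section \<open>Cocomparability orderings\<close>

text \<open>A relation on labels instead of an edge set, so that the same notion serves a graph on
  \<open>{1..l}\<close> and a graph on \<open>V\<close> read through an enumeration of its
  vertices.\<close>

definition umbrella_free :: "nat \<Rightarrow> (nat \<Rightarrow> nat \<Rightarrow> bool) \<Rightarrow> bool" where
  "umbrella_free l adj \<longleftrightarrow>
     (\<forall>i k j. 1 \<le> i \<longrightarrow> i < k \<longrightarrow> k < j \<longrightarrow> j \<le> l \<longrightarrow> adj i j \<longrightarrow> adj i k \<or> adj k j)"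

text \<open>Induction on the number of terms, with the endpoint \<open>j\<close> free. For the last
  but one term \<open>k\<close>, either the final link is an edge, or \<open>i\<close> and
  \<open>k\<close> are related and the shortened chain ending in \<open>k\<close> is covered by the
  induction hypothesis.\<close>

lemma umbrella_free_chain:
  fixes p :: "nat \<Rightarrow> nat"
  assumes "umbrella_free l adj" "1 \<le> i" "i < j" "j \<le> l" "adj i j"
    and "1 \<le> m" "strict_mono_on {1..m} p" "p 1 = i" "p m = j"
  shows "\<exists>a. 1 \<le> a \<and> a < m \<and> adj (p a) (p (a + 1))"
  using assms(3-)
proof (induction m arbitrary: j)
  case 0
  then show ?case by simp
next
  case (Suc m)
  have "m \<noteq> 0"
    using Suc.prems by (cases m) auto
  define k where "k = p m"
  have "k < j"
    using Suc.prems \<open>m \<noteq> 0\<close> strict_mono_onD[of "{1..Suc m}" p m "Suc m"] by (auto simp: k_def)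
  have mono: "strict_mono_on {1..m} p"
    using Suc.prems(5) by (rule monotone_on_subset) auto
  show ?case
  proof (cases "m = 1")
    case True
    then show ?thesis
      using Suc.prems by (intro exI[of _ 1]) (auto simp: numeral_2_eq_2)
  next
    case False
    then have "i < k"
      using Suc.prems \<open>m \<noteq> 0\<close> strict_mono_onD[OF mono, of 1 m] by (auto simp: k_def)
    then consider "adj i k" | "adj k j"
      using assms(1,2) Suc.prems \<open>k < j\<close> unfolding umbrella_free_def by blast
    then show ?thesis
    proof cases
      case 1
      then have "\<exists>a. 1 \<le> a \<and> a < m \<and> adj (p a) (p (a + 1))"
        using Suc.prems \<open>i < k\<close> \<open>k < j\<close> \<open>m \<noteq> 0\<close> mono by (intro Suc.IH[of k]) (auto simp: k_def)
      then show ?thesis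
        using less_SucI by blast
    next
      case 2
      then show ?thesis
        using Suc.prems \<open>m \<noteq> 0\<close> by (intro exI[of _ m]) (auto simp: k_def)
    qed
  qed
qed

text \<open>An umbrella is exactly a three-term chain none of whose links is an edge, and
  \<open>umbrella_free_chain\<close> reduces longer chains to these.\<close>

lemma umbrella_free_iff_chains:
  "umbrella_free l adj \<longleftrightarrow>
     (\<forall>i\<in>{1..l}. \<forall>j\<in>{1..l}. \<forall>m::nat. \<forall>p :: nat \<Rightarrow> nat.
        i < j \<and> adj i j \<and> 1 \<le> m \<and> strict_mono_on {1..m} p \<and> p 1 = i \<and> p m = j
        \<longrightarrow> (\<exists>a. 1 \<le> a \<and> a < m \<and> adj (p a) (p (a + 1))))" (is "_ \<longleftrightarrow> ?chains")
proof
  assume "umbrella_free l adj"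
  then show ?chains
    using umbrella_free_chain[of l adj] by (metis atLeastAtMost_iff)
next
  assume chains: ?chains
  show "umbrella_free l adj"
    unfolding umbrella_free_def
  proof (intro allI impI)
    fix i k j
    assume ikj: "1 \<le> i" "i < k" "k < j" "j \<le> l" "adj i j"
    define p where "p n = (if n = 1 then i else if n = 2 then k else j)" for n :: nat
    have "strict_mono_on {1..3} p"
      using ikj by (auto simp: strict_mono_on_def p_def)
    moreover have "i \<in> {1..l}" "j \<in> {1..l}" "i < j \<and> adj i j \<and> 1 \<le> (3::nat)" "p 1 = i \<and> p 3 = j"
      using ikj by (auto simp: p_def)
    ultimately obtain a where a: "1 \<le> a" "a < 3" "adj (p a) (p (a + 1))"
      using chains by blast
    then have "a = 1 \<or> a = 2" by auto
    then show "adj i k \<or> adj k j"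
      using a by (auto simp: p_def)
  qed
qed

text \<open>Sorting by the number of \<open>R\<close>-predecessors gives the enumeration: this
  number grows strictly along \<open>R\<close>, so ties occur only between unrelated
  elements.\<close>

lemma linear_extension_enumeration:
  assumes "finite V" "trans R" "irrefl R" "R \<subseteq> V \<times> V"
  obtains v :: "nat \<Rightarrow> 'a"
  where "bij_betw v {1..card V} V"
    and "\<And>i j. i \<in> {1..card V} \<Longrightarrow> j \<in> {1..card V} \<Longrightarrow> (v i, v j) \<in> R \<Longrightarrow> i < j"
proof -
  define h where "h x = card {y. (y, x) \<in> R}" for x
  have h: "h x < h y" if "(x, y) \<in> R" for x y
    unfolding h_def
  proof (rule psubset_card_mono)
    show "finite {z. (z, y) \<in> R}"
      using assms by (auto intro: finite_subset)
    show "{z. (z, x) \<in> R} \<subset> {z. (z, y) \<in> R}"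
      \<comment> \<open>Transitivity gives the inclusion; it is strict because \<open>x\<close>
        precedes \<open>y\<close> but, by irreflexivity, not itself.\<close>
      using assms(2,3) that unfolding irrefl_def by (blast dest: transD)
  qed
  obtain ws where ws: "set ws = V" "distinct ws"
    using assms(1) finite_distinct_list by blast
  define xs where "xs = sort_key h ws"
  have xs: "set xs = V" "distinct xs" "sorted (map h xs)"
    using ws by (simp_all add: xs_def)
  have len: "length xs = card V"
    using xs distinct_card by fastforce
  define v where "v i = xs ! (i - 1)" for i
  show ?thesis
  proof
    have "bij_betw (\<lambda>i. i - 1) {1..card V} {..<length xs}"
      unfolding len by (rule bij_betw_byWitness[where f' = Suc]) auto
    moreover have "bij_betw ((!) xs) {..<length xs} V"
      using xs bij_betw_nth by blast
    ultimately show "bij_betw v {1..card V} V"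
      unfolding v_def using bij_betw_trans[unfolded comp_def] by blast
  next
    fix i j
    assume ij: "i \<in> {1..card V}" "j \<in> {1..card V}" "(v i, v j) \<in> R"
    show "i < j"
    proof (rule ccontr)
      assume "\<not> i < j"
      then have "h (v j) \<le> h (v i)"
        using ij xs(3) sorted_nth_mono[of "map h xs" "j - 1" "i - 1"] len by (auto simp: v_def)
      then show False
        using h[OF ij(3)] by simp
    qed
  qed
qed

text \<open>Umbrella-freeness says that the non-edges, oriented upwards along the enumeration, form
  a transitive relation. Conversely, an enumeration extending a transitive orientation of the
  complement orients every non-edge upwards.\<close>

lemma cocomparability_graph_iff_umbrella_free:
  assumes G: "finite_simple_graph V E"
  shows "cocomparability_graph V E \<longleftrightarrow>
    (\<exists>v. bij_betw v {1..card V} V \<and> umbrella_free (card V) (\<lambda>i j. {v i, v j} \<in> E))"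
proof
  assume "cocomparability_graph V E"
  then obtain R where R: "orientation (all_pairs V - E) R" "trans R"
    by (auto simp: cocomparability_graph_def comparability_graph_def)
  have pairs: "{x, y} \<in> all_pairs V - E" if "(x, y) \<in> R" for x y
    using R(1) that unfolding orientation_def by blast
  have "x \<in> V \<and> y \<in> V \<and> x \<noteq> y" if "(x, y) \<in> R" for x y
    using pairs[OF that] by (auto simp: all_pairs_def)
  then have "R \<subseteq> V \<times> V" "irrefl R"
    by (auto intro: irreflI)
  moreover have "finite V"
    using G by (simp add: finite_simple_graph_def)
  ultimately obtain v where v: "bij_betw v {1..card V} V"
    "\<And>i j. i \<in> {1..card V} \<Longrightarrow> j \<in> {1..card V} \<Longrightarrow> (v i, v j) \<in> R \<Longrightarrow> i < j"
    using linear_extension_enumeration[of V R] R(2) by metis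
  have oriented: "(v i, v j) \<in> R" if "1 \<le> i" "i < j" "j \<le> card V" "{v i, v j} \<notin> E" for i j
  proof -
    have "v i \<noteq> v j"
      using v(1) that by (auto simp: bij_betw_def inj_on_eq_iff)
    moreover have "v i \<in> V" "v j \<in> V"
      using v(1) that by (auto simp: bij_betw_def)
    ultimately have "{v i, v j} \<in> all_pairs V - E"
      using that by (simp add: all_pairs_def)
    moreover have "(v j, v i) \<notin> R"
      using v(2)[of j i] that by auto
    ultimately show ?thesis
      using R(1) unfolding orientation_def by blast
  qed
  have "umbrella_free (card V) (\<lambda>i j. {v i, v j} \<in> E)"
    unfolding umbrella_free_def
  proof (intro allI impI)
    fix i k j
    assume ikj: "1 \<le> i" "i < k" "k < j" "j \<le> card V" "{v i, v j} \<in> E"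
    show "{v i, v k} \<in> E \<or> {v k, v j} \<in> E"
    proof (rule ccontr)
      assume "\<not> ?thesis"
      then have "(v i, v k) \<in> R" "(v k, v j) \<in> R"
        using oriented ikj by auto
      then show False
        using pairs ikj(5) transD[OF R(2)] by blast
    qed
  qed
  then show "\<exists>v. bij_betw v {1..card V} V \<and> umbrella_free (card V) (\<lambda>i j. {v i, v j} \<in> E)"
    using v(1) by blast
next
  assume "\<exists>v. bij_betw v {1..card V} V \<and> umbrella_free (card V) (\<lambda>i j. {v i, v j} \<in> E)"
  then obtain v where v: "bij_betw v {1..card V} V"
    and uf: "umbrella_free (card V) (\<lambda>i j. {v i, v j} \<in> E)" by blast
  define R where "R = {(v i, v j) | i j. 1 \<le> i \<and> i < j \<and> j \<le> card V \<and> {v i, v j} \<notin> E}"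
  have inj: "v i = v j \<longleftrightarrow> i = j" if "i \<in> {1..card V}" "j \<in> {1..card V}" for i j
    using v that by (auto simp: bij_betw_def inj_on_eq_iff)
  have R: "(v i, v j) \<in> R \<longleftrightarrow> i < j \<and> {v i, v j} \<notin> E"
    if "i \<in> {1..card V}" "j \<in> {1..card V}" for i j
  proof
    assume "(v i, v j) \<in> R"
    then obtain i' j' where *: "v i = v i'" "v j = v j'" "1 \<le> i'" "i' < j'" "j' \<le> card V"
      "{v i', v j'} \<notin> E"
      unfolding R_def by blast
    then have "i = i'" "j = j'"
      using inj[of i i'] inj[of j j'] that by auto
    then show "i < j \<and> {v i, v j} \<notin> E"
      using * by simp
  next
    assume "i < j \<and> {v i, v j} \<notin> E"
    then show "(v i, v j) \<in> R"
      using that unfolding R_def by auto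
  qed
  have "trans R"
  proof (rule transI)
    fix x y z
    assume xyz: "(x, y) \<in> R" "(y, z) \<in> R"
    obtain i k where ik: "x = v i" "y = v k" "1 \<le> i" "i < k" "k \<le> card V" "{v i, v k} \<notin> E"
      using xyz(1) unfolding R_def by blast
    obtain k' j where kj: "y = v k'" "z = v j" "1 \<le> k'" "k' < j" "j \<le> card V" "{v k', v j} \<notin> E"
      using xyz(2) unfolding R_def by blast
    note * = ik kj
    then have "k' = k"
      using inj[of k' k] * by auto
    then have "{v i, v j} \<notin> E"
      using uf * unfolding umbrella_free_def by blast
    then show "(x, z) \<in> R"
      unfolding R_def using * \<open>k' = k\<close> by (intro CollectI exI[of _ i] exI[of _ j]) auto
  qed
  moreover have "orientation (all_pairs V - E) R"
    unfolding orientation_def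
  proof (intro conjI allI impI)
    fix x y
    assume "(x, y) \<in> R"
    then obtain i j where *: "x = v i" "y = v j" "i < j" "i \<in> {1..card V}" "j \<in> {1..card V}"
      "{x, y} \<notin> E"
      unfolding R_def by fastforce
    then show "{x, y} \<in> all_pairs V - E"
      using inj[of i j] v by (auto simp: all_pairs_def bij_betw_def)
  next
    fix x y
    assume xy: "{x, y} \<in> all_pairs V - E"
    then have "x \<in> V" "y \<in> V" "x \<noteq> y"
      by (auto simp: all_pairs_def)
    then obtain i j where "x = v i" "y = v j" "i \<in> {1..card V}" "j \<in> {1..card V}" "i \<noteq> j"
      using v unfolding bij_betw_def by blast
    then show "(x, y) \<in> R \<longleftrightarrow> (y, x) \<notin> R"
      using R[of i j] R[of j i] xy by (auto simp: insert_commute)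
  qed
  ultimately show "cocomparability_graph V E"
    using G by (auto simp: cocomparability_graph_def comparability_graph_def finite_simple_graph_def)
qed

section \<open>Alcoves in coordinates\<close>

locale type_A =
  fixes \<epsilon> :: "nat \<Rightarrow> 'e::euclidean_space" and l :: nat
  assumes bij: "bij_betw \<epsilon> {1..l} Basis"
begin

abbreviation U :: "'e set" where "U \<equiv> zero_sum_space \<epsilon> l"

lemma inner_\<epsilon>:
  assumes "p \<in> {1..l}" "q \<in> {1..l}"
  shows "\<epsilon> p \<bullet> \<epsilon> q = (if p = q then 1 else 0)"
proof -
  have "\<epsilon> p \<in> Basis" "\<epsilon> q \<in> Basis" "\<epsilon> p = \<epsilon> q \<longleftrightarrow> p = q"
    using bij assms by (auto simp: bij_betw_def inj_on_eq_iff)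
  then show ?thesis
    by (simp add: inner_Basis)
qed

lemma inner_sum_\<epsilon>:
  assumes "p \<in> {1..l}"
  shows "\<epsilon> p \<bullet> (\<Sum>i=1..l. r i *\<^sub>R \<epsilon> i) = r p"
proof -
  have "\<epsilon> p \<bullet> (\<Sum>i=1..l. r i *\<^sub>R \<epsilon> i) = (\<Sum>i=1..l. if p = i then r i else 0)"
    unfolding inner_sum_right using assms inner_\<epsilon> by (intro sum.cong) auto
  then show ?thesis
    using assms by simp
qed

lemma \<epsilon>_representation: "(\<Sum>i=1..l. (\<epsilon> i \<bullet> x) *\<^sub>R \<epsilon> i) = x"
proof -
  have "(\<Sum>i=1..l. (\<epsilon> i \<bullet> x) *\<^sub>R \<epsilon> i) = (\<Sum>b\<in>Basis. (b \<bullet> x) *\<^sub>R b)"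
    by (rule sum.reindex_bij_betw[OF bij])
  then show ?thesis
    using euclidean_representation[of x] by (metis (no_types, lifting) inner_commute sum.cong)
qed

lemma mem_U_iff: "x \<in> U \<longleftrightarrow> (\<Sum>i=1..l. \<epsilon> i \<bullet> x) = 0"
proof
  assume "x \<in> U"
  then obtain r where "x = (\<Sum>i=1..l. r i *\<^sub>R \<epsilon> i)" "(\<Sum>i=1..l. r i) = 0"
    by (auto simp: zero_sum_space_def)
  then show "(\<Sum>i=1..l. \<epsilon> i \<bullet> x) = 0"
    using inner_sum_\<epsilon> by simp
next
  assume "(\<Sum>i=1..l. \<epsilon> i \<bullet> x) = 0"
  then show "x \<in> U"
    unfolding zero_sum_space_def
    by (intro CollectI exI[of _ "\<lambda>i. \<epsilon> i \<bullet> x"] conjI \<epsilon>_representation[symmetric])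
qed

lemma U_eq_hyperplane: "U = {x. (\<Sum>i=1..l. \<epsilon> i) \<bullet> x = 0}"
  by (auto simp: mem_U_iff inner_sum_left)

lemma affine_U: "affine U" and closed_U: "closed U" and zero_in_U: "0 \<in> U"
  unfolding U_eq_hyperplane by (auto intro: affine_hyperplane closed_hyperplane)

lemma convex_U: "convex U"
  by (rule affine_imp_convex[OF affine_U])

text \<open>Orthogonal projection to \<open>U\<close>: subtracting the mean keeps all differences of
  coordinates, so a point may be prescribed by coordinates of arbitrary sum.\<close>

definition of_coords :: "(nat \<Rightarrow> real) \<Rightarrow> 'e" where
  "of_coords w = (\<Sum>i=1..l. (w i - (\<Sum>j=1..l. w j) / l) *\<^sub>R \<epsilon> i)"

lemma of_coords_in_U: "of_coords w \<in> U"
  unfolding zero_sum_space_def of_coords_def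
  by (cases "l = 0") (auto intro!: exI[of _ "\<lambda>i. w i - (\<Sum>j=1..l. w j) / l"] simp: sum_subtractf)

lemma diff_of_coords:
  assumes "p \<in> {1..l}" "q \<in> {1..l}"
  shows "(\<epsilon> p - \<epsilon> q) \<bullet> of_coords w = w p - w q"
  using inner_sum_\<epsilon>[OF assms(1)] inner_sum_\<epsilon>[OF assms(2)] by (simp add: of_coords_def inner_diff_left)

lemma mem_aff_hyperplane:
  "x \<in> aff_hyperplane \<epsilon> l (\<epsilon> p - \<epsilon> q) m \<longleftrightarrow> x \<in> U \<and> (\<epsilon> p - \<epsilon> q) \<bullet> x = of_int m"
  by (auto simp: aff_hyperplane_def)

text \<open>Inequalities are indexed below by ordered pairs in both directions, walls and ceilings
  by positive roots; this passes between the two.\<close>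

lemma aff_hyperplane_flip:
  "aff_hyperplane \<epsilon> l (\<epsilon> p - \<epsilon> q) m = aff_hyperplane \<epsilon> l (\<epsilon> q - \<epsilon> p) (- m)"
  by (auto simp: mem_aff_hyperplane inner_diff_left)

text \<open>Quantifying over all ordered pairs keeps the condition symmetric; for the complement of
  the hyperplanes it agrees with the condition on positive roots.\<close>

definition regular :: "'e \<Rightarrow> bool" where
  "regular x \<longleftrightarrow> x \<in> U \<and> (\<forall>p\<in>{1..l}. \<forall>q\<in>{1..l}. p \<noteq> q \<longrightarrow> (\<epsilon> p - \<epsilon> q) \<bullet> x \<notin> \<int>)"

lemma complement_of_hyperplanes:
  "U - (\<Union>\<alpha>\<in>pos_roots \<epsilon> l. \<Union>m. aff_hyperplane \<epsilon> l \<alpha> m) = {x. regular x}"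
proof -
  have *: "(\<exists>\<alpha>\<in>pos_roots \<epsilon> l. \<exists>m. x \<in> aff_hyperplane \<epsilon> l \<alpha> m) \<longleftrightarrow>
      (\<exists>p\<in>{1..l}. \<exists>q\<in>{1..l}. p \<noteq> q \<and> (\<epsilon> p - \<epsilon> q) \<bullet> x \<in> \<int>)" if "x \<in> U" for x
  proof
    assume "\<exists>\<alpha>\<in>pos_roots \<epsilon> l. \<exists>m. x \<in> aff_hyperplane \<epsilon> l \<alpha> m"
    then obtain p q m where "1 \<le> p" "p < q" "q \<le> l" "x \<in> aff_hyperplane \<epsilon> l (\<epsilon> p - \<epsilon> q) m"
      by (auto simp: pos_roots_def)
    then show "\<exists>p\<in>{1..l}. \<exists>q\<in>{1..l}. p \<noteq> q \<and> (\<epsilon> p - \<epsilon> q) \<bullet> x \<in> \<int>"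
      by (intro bexI[of _ p] bexI[of _ q]) (auto simp: mem_aff_hyperplane)
  next
    assume "\<exists>p\<in>{1..l}. \<exists>q\<in>{1..l}. p \<noteq> q \<and> (\<epsilon> p - \<epsilon> q) \<bullet> x \<in> \<int>"
    then obtain p q m where *: "p \<in> {1..l}" "q \<in> {1..l}" "p \<noteq> q"
      "(\<epsilon> p - \<epsilon> q) \<bullet> x = of_int m"
      by (auto elim!: Ints_cases)
    show "\<exists>\<alpha>\<in>pos_roots \<epsilon> l. \<exists>m. x \<in> aff_hyperplane \<epsilon> l \<alpha> m"
    proof (cases "p < q")
      case True
      then have "\<epsilon> p - \<epsilon> q \<in> pos_roots \<epsilon> l"
        using * by (auto simp: pos_roots_def)
      moreover have "x \<in> aff_hyperplane \<epsilon> l (\<epsilon> p - \<epsilon> q) m"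
        using * that by (simp add: mem_aff_hyperplane)
      ultimately show ?thesis by blast
    next
      case False
      then have "\<epsilon> q - \<epsilon> p \<in> pos_roots \<epsilon> l"
        using * unfolding pos_roots_def by (intro CollectI exI[of _ q] exI[of _ p]) auto
      moreover have "x \<in> aff_hyperplane \<epsilon> l (\<epsilon> q - \<epsilon> p) (- m)"
        using * that by (simp add: mem_aff_hyperplane aff_hyperplane_flip[symmetric])
      ultimately show ?thesis by blast
    qed
  qed
  show ?thesis
  proof (rule set_eqI)
    show "x \<in> U - (\<Union>\<alpha>\<in>pos_roots \<epsilon> l. \<Union>m. aff_hyperplane \<epsilon> l \<alpha> m) \<longleftrightarrow> x \<in> {x. regular x}" for x
      using *[of x] by (cases "x \<in> U") (simp_all add: regular_def imp_conv_disj)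
  qed
qed

text \<open>The root of \<open>(p, q)\<close> is the sum of the simple roots from \<open>p\<close>
  to \<open>q - 1\<close>.\<close>

lemma pos_if_simple_pos:
  assumes "\<And>t. 1 \<le> t \<Longrightarrow> t < l \<Longrightarrow> 0 < (\<epsilon> t - \<epsilon> (t + 1)) \<bullet> x"
    and "1 \<le> p" "p < q" "q \<le> l"
  shows "0 < (\<epsilon> p - \<epsilon> q) \<bullet> x"
proof -
  have "p + 1 \<le> q" using assms by simp
  then show ?thesis
    using \<open>q \<le> l\<close>
  proof (induction q rule: dec_induct)
    case base
    then show ?case using assms by simp
  next
    case (step n)
    then show ?case
      using assms(1)[of n] \<open>1 \<le> p\<close> by (simp add: inner_diff_left)
  qed
qed

end

section \<open>Levels and gaps of a regular point, and its alcove\<close>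

locale alcove_point = type_A \<epsilon> l for \<epsilon> :: "nat \<Rightarrow> 'e::euclidean_space" and l :: nat +
  fixes a :: 'e
  assumes regular_a: "regular a"
begin

definition level :: "nat \<Rightarrow> nat \<Rightarrow> int" where
  "level p q = \<lfloor>(\<epsilon> p - \<epsilon> q) \<bullet> a\<rfloor>"

definition gap :: "nat \<Rightarrow> nat \<Rightarrow> real" where
  "gap p q = frac ((\<epsilon> p - \<epsilon> q) \<bullet> a)"

text \<open>Lower bounds alone suffice: by \<open>level_flip\<close> the bound for
  \<open>(q, p)\<close> is the upper bound \<open>level p q + 1\<close> for
  \<open>(p, q)\<close>.\<close>

definition alcove :: "'e set" where
  "alcove = {x \<in> U. \<forall>p\<in>{1..l}. \<forall>q\<in>{1..l}. p \<noteq> q \<longrightarrow> of_int (level p q) < (\<epsilon> p - \<epsilon> q) \<bullet> x}"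

text \<open>The residues of the coordinates modulo 1 are cyclically ordered; \<open>q\<close> follows \<open>p\<close>
  immediately in decreasing order.\<close>

definition adjacent :: "nat \<Rightarrow> nat \<Rightarrow> bool" where
  "adjacent p q \<longleftrightarrow> p \<noteq> q \<and> (\<forall>r\<in>{1..l}. r \<noteq> p \<longrightarrow> gap p q \<le> gap p r)"

lemma a_in_U: "a \<in> U"
  using regular_a by (simp add: regular_def)

lemma level_plus_gap: "(\<epsilon> p - \<epsilon> q) \<bullet> a = of_int (level p q) + gap p q"
  by (simp add: level_def gap_def frac_def)

lemma gap_less_1: "gap p q < 1"
  by (simp add: gap_def frac_lt_1)

context
  fixes p q assumes pq: "p \<in> {1..l}" "q \<in> {1..l}" "p \<noteq> q"
begin

lemma not_int: "(\<epsilon> p - \<epsilon> q) \<bullet> a \<notin> \<int>"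
  using regular_a pq by (auto simp: regular_def)

lemma gap_pos: "0 < gap p q"
  using not_int by (simp add: gap_def)

lemma level_flip: "level q p = - level p q - 1"
proof -
  have "(\<epsilon> q - \<epsilon> p) \<bullet> a = - of_int (level p q) - gap p q"
    using level_plus_gap[of p q] by (simp add: inner_diff_left)
  then show ?thesis
    unfolding level_def[of q p] using gap_pos gap_less_1[of p q] by linarith
qed

text \<open>Equal gaps would make coordinates \<open>r\<close> and \<open>q\<close> of
  \<open>a\<close> differ by an integer.\<close>

lemma gap_eq_imp:
  assumes "r \<in> {1..l}" "r \<noteq> q"
  shows "gap p r \<noteq> gap p q"
proof
  assume "gap p r = gap p q"
  then have "(\<epsilon> r - \<epsilon> q) \<bullet> a = of_int (level p q - level p r)"
    using level_plus_gap[of p q] level_plus_gap[of p r] by (simp add: inner_diff_left)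
  then have "(\<epsilon> r - \<epsilon> q) \<bullet> a \<in> \<int>"
    by (metis Ints_of_int)
  then show False
    using regular_a pq assms by (auto simp: regular_def)
qed

text \<open>If the residue of \<open>r\<close> lies on the arc from \<open>p\<close> down to
  \<open>q\<close>, the two partial arcs add up without wrapping around the circle, so levels and
  gaps are both additive.\<close>

lemma split_pair:
  assumes r: "r \<in> {1..l}" "r \<noteq> p" "gap p r < gap p q"
  shows "r \<noteq> q" "level p q = level p r + level r q" "gap r q = gap p q - gap p r"
proof -
  show "r \<noteq> q" using r by auto
  have sum: "of_int (level p q) + gap p q = of_int (level p r) + gap p r + (\<epsilon> r - \<epsilon> q) \<bullet> a"
    using level_plus_gap[of p q] level_plus_gap[of p r] by (simp add: inner_diff_left)
  moreover have "0 \<le> gap p q - gap p r" "gap p q - gap p r < 1"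
    using r gap_less_1[of p q] frac_ge_0 unfolding gap_def by (smt (verit))+
  ultimately have "level r q = level p q - level p r"
    unfolding level_def[of r q] by (intro floor_unique) auto
  then show "level p q = level p r + level r q" by simp
  then show "gap r q = gap p q - gap p r"
    using sum level_plus_gap[of r q] by simp
qed

end

lemma a_in_alcove: "a \<in> alcove"
  unfolding alcove_def using a_in_U level_plus_gap gap_pos by auto

lemma alcove_lower_bound:
  assumes "x \<in> alcove" "p \<in> {1..l}" "q \<in> {1..l}" "p \<noteq> q"
  shows "of_int (level p q) < (\<epsilon> p - \<epsilon> q) \<bullet> x"
  using assms by (auto simp: alcove_def)

lemma alcove_upper_bound:
  assumes "x \<in> alcove" "p \<in> {1..l}" "q \<in> {1..l}" "p \<noteq> q"
  shows "(\<epsilon> p - \<epsilon> q) \<bullet> x < of_int (level p q) + 1"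
proof -
  have "of_int (level q p) < (\<epsilon> q - \<epsilon> p) \<bullet> x"
    using assms by (intro alcove_lower_bound) auto
  then show ?thesis
    using level_flip[of p q] assms by (simp add: inner_diff_left)
qed

lemma convex_alcove: "convex alcove"
proof -
  have "alcove = U \<inter> (\<Inter>p\<in>{1..l}. \<Inter>q\<in>{1..l} - {p}. {x. (\<epsilon> p - \<epsilon> q) \<bullet> x > of_int (level p q)})"
    by (auto simp: alcove_def)
  then show ?thesis
    by (auto intro!: convex_Int convex_U convex_INT convex_halfspace_gt)
qed

lemma regular_if_in_alcove:
  assumes "x \<in> alcove"
  shows "regular x"
  unfolding regular_def
proof (intro conjI ballI impI)
  show "x \<in> U" using assms by (simp add: alcove_def)
  fix p q assume pq: "p \<in> {1..l}" "q \<in> {1..l}" "p \<noteq> q"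
  then have "of_int (level p q) < (\<epsilon> p - \<epsilon> q) \<bullet> x" "(\<epsilon> p - \<epsilon> q) \<bullet> x < of_int (level p q) + 1"
    using assms alcove_upper_bound by (auto simp: alcove_def)
  then show "(\<epsilon> p - \<epsilon> q) \<bullet> x \<notin> \<int>"
    by (auto elim!: Ints_cases)
qed

text \<open>The alcove is convex, hence connected. A connected set that contains \<open>a\<close>
  and leaves the alcove takes some integral value \<open>level p q\<close> by the intermediate value
  theorem, so it contains a point that is not regular.\<close>

lemma connected_component_eq_alcove: "connected_component_set {x. regular x} a = alcove"
proof (rule connected_component_unique)
  show "a \<in> alcove" by (rule a_in_alcove)
  show "alcove \<subseteq> {x. regular x}" using regular_if_in_alcove by auto
  show "connected alcove" by (rule convex_connected[OF convex_alcove])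
next
  fix C assume C: "a \<in> C" "C \<subseteq> {x. regular x}" "connected C"
  show "C \<subseteq> alcove"
  proof
    fix x assume x: "x \<in> C"
    show "x \<in> alcove"
      unfolding alcove_def
    proof (intro CollectI conjI ballI impI)
      show "x \<in> U" using x C by (auto simp: regular_def)
      fix p q assume pq: "p \<in> {1..l}" "q \<in> {1..l}" "p \<noteq> q"
      show "of_int (level p q) < (\<epsilon> p - \<epsilon> q) \<bullet> x"
      proof (rule ccontr)
        assume "\<not> ?thesis"
        then have "(\<epsilon> p - \<epsilon> q) \<bullet> x \<le> of_int (level p q)" by simp
        moreover have "of_int (level p q) \<le> (\<epsilon> p - \<epsilon> q) \<bullet> a"
          using level_plus_gap[of p q] gap_pos[OF pq] by simp
        ultimately obtain z where "z \<in> C" "(\<epsilon> p - \<epsilon> q) \<bullet> z = of_int (level p q)"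
          using connected_ivt_hyperplane[OF C(3) x C(1)] by blast
        then have "regular z" "(\<epsilon> p - \<epsilon> q) \<bullet> z \<in> \<int>"
          using C(2) by auto
        then show False
          using pq by (auto simp: regular_def)
      qed
    qed
  qed
qed

lemma alcove_in_alcoves: "alcove \<in> alcoves \<epsilon> l"
  unfolding alcoves_def complement_of_hyperplanes components_def
  using connected_component_eq_alcove regular_a by auto

section \<open>The closed alcove and its tight inequalities\<close>

definition tight :: "'e \<Rightarrow> nat \<Rightarrow> nat \<Rightarrow> bool" where
  "tight x p q \<longleftrightarrow> (\<epsilon> p - \<epsilon> q) \<bullet> x = of_int (level p q)"

definition closed_alcove :: "'e set" where
  "closed_alcove = {x \<in> U. \<forall>p\<in>{1..l}. \<forall>q\<in>{1..l}. p \<noteq> q \<longrightarrow> of_int (level p q) \<le> (\<epsilon> p - \<epsilon> q) \<bullet> x}"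

text \<open>Inequalities that are strict at \<open>a\<close> and weak at \<open>y\<close> are strict
  on the open segment between them, so every \<open>y\<close> satisfying the weak ones is a limit of
  points of the alcove.\<close>

lemma closure_alcove: "closure alcove = closed_alcove"
proof
  have "closed_alcove = U \<inter> (\<Inter>p\<in>{1..l}. \<Inter>q\<in>{1..l} - {p}. {x. (\<epsilon> p - \<epsilon> q) \<bullet> x \<ge> of_int (level p q)})"
    by (auto simp: closed_alcove_def)
  then have "closed closed_alcove"
    by (auto intro!: closed_Int closed_U closed_INT closed_halfspace_ge)
  then show "closure alcove \<subseteq> closed_alcove"
    by (intro closure_minimal) (fastforce simp: alcove_def closed_alcove_def)+
next
  show "closed_alcove \<subseteq> closure alcove"
  proof
    fix y assume y: "y \<in> closed_alcove"
    show "y \<in> closure alcove"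
    proof (cases "y = a")
      case True
      then show ?thesis
        using a_in_alcove closure_subset by auto
    next
      case False
      have "open_segment a y \<subseteq> alcove"
      proof
        fix x assume "x \<in> open_segment a y"
        then obtain u where u: "0 < u" "u < 1" and x: "x = (1 - u) *\<^sub>R a + u *\<^sub>R y"
          by (auto simp: in_segment)
        show "x \<in> alcove"
          unfolding alcove_def
        proof (intro CollectI conjI ballI impI)
          show "x \<in> U"
            unfolding x using y u a_in_U by (intro convexD[OF convex_U]) (auto simp: closed_alcove_def)
          fix p q assume pq: "p \<in> {1..l}" "q \<in> {1..l}" "p \<noteq> q"
          have "(1 - u) * of_int (level p q) < (1 - u) * ((\<epsilon> p - \<epsilon> q) \<bullet> a)"
            using u level_plus_gap[of p q] gap_pos[OF pq] by (intro mult_strict_left_mono) auto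
          moreover have "u * of_int (level p q) \<le> u * ((\<epsilon> p - \<epsilon> q) \<bullet> y)"
            using u y pq by (intro mult_left_mono) (auto simp: closed_alcove_def)
          ultimately show "of_int (level p q) < (\<epsilon> p - \<epsilon> q) \<bullet> x"
            unfolding x by (simp add: inner_add_right algebra_simps)
        qed
      qed
      then have "closure (open_segment a y) \<subseteq> closure alcove"
        by (rule closure_mono)
      then show ?thesis
        using False by auto
    qed
  qed
qed

lemma closed_alcove_upper_bound:
  assumes "x \<in> closed_alcove" "p \<in> {1..l}" "q \<in> {1..l}" "p \<noteq> q"
  shows "(\<epsilon> p - \<epsilon> q) \<bullet> x \<le> of_int (level p q) + 1"
proof -
  have "of_int (level q p) \<le> (\<epsilon> q - \<epsilon> p) \<bullet> x"
    using assms by (auto simp: closed_alcove_def)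
  then show ?thesis
    using level_flip[of p q] assms by (simp add: inner_diff_left)
qed

lemma convex_closed_alcove: "convex closed_alcove"
  unfolding closure_alcove[symmetric] by (rule convex_closure[OF convex_alcove])

text \<open>On the closed alcove the difference ranges over an interval of length 1 with integral
  endpoints, so an integral value is one of the two ends; the upper end is tightness of the reversed
  pair.\<close>

lemma tight_cases:
  assumes "x \<in> closed_alcove" "p \<in> {1..l}" "q \<in> {1..l}" "p \<noteq> q" "(\<epsilon> p - \<epsilon> q) \<bullet> x = of_int m"
  obtains "tight x p q" "m = level p q" | "tight x q p" "m = - level q p"
proof -
  have "real_of_int (level p q) \<le> of_int m"
    using assms unfolding closed_alcove_def by fastforce
  moreover have "real_of_int m \<le> of_int (level p q) + 1"
    using closed_alcove_upper_bound[OF assms(1-4)] assms(5) by simp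
  ultimately have "level p q \<le> m" "m \<le> level p q + 1"
    by linarith+
  then consider "m = level p q" | "m = - level q p"
    using level_flip[OF assms(2-4)] by linarith
  then show thesis
    using assms(5) that by cases (auto simp: tight_def inner_diff_left)
qed

text \<open>The slack of \<open>(p, q)\<close> is the sum of the nonnegative slacks of
  \<open>(p, r)\<close> and \<open>(r, q)\<close>, so if it vanishes, both do.\<close>

lemma tight_split:
  assumes "x \<in> closed_alcove" "p \<in> {1..l}" "q \<in> {1..l}" "p \<noteq> q" "tight x p q"
    and "r \<in> {1..l}" "r \<noteq> p" "gap p r < gap p q"
  shows "tight x p r" "tight x r q"
proof -
  note split = split_pair[OF assms(2-4,6-8)]
  have "of_int (level p r) \<le> (\<epsilon> p - \<epsilon> r) \<bullet> x" "of_int (level r q) \<le> (\<epsilon> r - \<epsilon> q) \<bullet> x"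
    using assms split(1) by (auto simp: closed_alcove_def)
  moreover have "(\<epsilon> p - \<epsilon> q) \<bullet> x = (\<epsilon> p - \<epsilon> r) \<bullet> x + (\<epsilon> r - \<epsilon> q) \<bullet> x"
    by (simp add: inner_diff_left)
  ultimately show "tight x p r" "tight x r q"
    using assms(5) split(2) by (auto simp: tight_def)
qed

text \<open>Lowering the coordinate \<open>p\<close> of \<open>a\<close> until its residue hits that of its successor \<open>q\<close>
  reaches a point of the closure at which \<open>(p, q)\<close> is the only tight pair.\<close>

lemma adjacent_point:
  assumes p: "p \<in> {1..l}" and q: "q \<in> {1..l}" and adj: "adjacent p q"
  obtains y where "y \<in> closed_alcove" "tight y p q"
    "\<And>r s. r \<in> {1..l} \<Longrightarrow> s \<in> {1..l} \<Longrightarrow> r \<noteq> s \<Longrightarrow> (r, s) \<noteq> (p, q) \<Longrightarrow>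
       of_int (level r s) < (\<epsilon> r - \<epsilon> s) \<bullet> y"
proof -
  have "p \<noteq> q" using adj by (simp add: adjacent_def)
  define y where "y = of_coords (\<lambda>i. \<epsilon> i \<bullet> a - (if i = p then gap p q else 0))"
  have y: "(\<epsilon> r - \<epsilon> s) \<bullet> y = of_int (level r s) + gap r s - (if r = p then gap p q else 0)
      + (if s = p then gap p q else 0)" if "r \<in> {1..l}" "s \<in> {1..l}" for r s
    using level_plus_gap[of r s] unfolding y_def diff_of_coords[OF that] by (simp add: inner_diff_left)
  have tight: "tight y p q"
    using y[OF p q] \<open>p \<noteq> q\<close> by (simp add: tight_def)
  have strict: "of_int (level r s) < (\<epsilon> r - \<epsilon> s) \<bullet> y"
    if rs: "r \<in> {1..l}" "s \<in> {1..l}" "r \<noteq> s" "(r, s) \<noteq> (p, q)" for r s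
  \<comment> \<open>Only pairs starting with \<open>p\<close> lose slack. For them adjacency and the
    distinctness of residues put \<open>gap p s\<close> strictly above \<open>gap p q\<close>, the
    amount lost.\<close>
  proof (cases "r = p")
    case True
    then have "gap p q < gap p s"
      using adj rs gap_eq_imp[OF p q \<open>p \<noteq> q\<close> rs(2)] by (force simp: adjacent_def)
    then show ?thesis
      using y[OF rs(1,2)] True rs by simp
  next
    case False
    then show ?thesis
      using y[OF rs(1,2)] gap_pos[OF rs(1-3)] gap_pos[OF p q \<open>p \<noteq> q\<close>] by (cases "s = p") auto
  qed
  have "y \<in> U"
    by (simp add: y_def of_coords_in_U)
  then have "y \<in> closed_alcove"
    using tight strict unfolding closed_alcove_def tight_def
    by (smt (verit, best) mem_Collect_eq Pair_inject)
  then show thesis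
    using that tight strict by blast
qed

section \<open>Facets of the closed alcove\<close>

lemma open_strict_pairs:
  "open {x. \<forall>r\<in>{1..l}. \<forall>s\<in>{1..l}. (r, s) \<in> I \<longrightarrow> of_int (level r s) < (\<epsilon> r - \<epsilon> s) \<bullet> x}"
proof -
  have "{x. \<forall>r\<in>{1..l}. \<forall>s\<in>{1..l}. (r, s) \<in> I \<longrightarrow> of_int (level r s) < (\<epsilon> r - \<epsilon> s) \<bullet> x} =
      (\<Inter>r\<in>{1..l}. \<Inter>s\<in>{s \<in> {1..l}. (r, s) \<in> I}. {x. (\<epsilon> r - \<epsilon> s) \<bullet> x > of_int (level r s)})"
    by auto
  then show ?thesis
    by (simp only:) (intro open_INT finite_atLeastAtMost finite_Collect_conjI ballI open_halfspace_gt; simp)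
qed

text \<open>The alcove is nonempty and relatively open in \<open>U\<close>, so it already spans
  \<open>U\<close>. This fixes the dimension against which facets are measured.\<close>

lemma affine_hull_closed_alcove: "affine hull closed_alcove = U"
proof
  show "affine hull closed_alcove \<subseteq> U"
    by (intro hull_minimal affine_U) (auto simp: closed_alcove_def)
  define W where "W = {x. \<forall>r\<in>{1..l}. \<forall>s\<in>{1..l}. (r, s) \<in> {(r, s). r \<noteq> s} \<longrightarrow>
    of_int (level r s) < (\<epsilon> r - \<epsilon> s) \<bullet> x}"
  have "alcove = U \<inter> W"
    by (auto simp: alcove_def W_def)
  moreover have "open W"
    unfolding W_def by (rule open_strict_pairs)
  ultimately have "affine hull alcove = U"
    using affine_hull_affine_Int_open[OF affine_U, of W] a_in_alcove
      affine_hull_eq[THEN iffD2, OF affine_U] by (metis empty_iff)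
  then show "U \<subseteq> affine hull closed_alcove"
    using hull_mono[of alcove closed_alcove affine] closure_alcove closure_subset by metis
qed

lemma face_tight:
  assumes "p \<in> {1..l}" "q \<in> {1..l}" "p \<noteq> q"
  shows "{x \<in> closed_alcove. tight x p q} face_of closed_alcove"
proof -
  have "closed_alcove \<inter> {x. (\<epsilon> p - \<epsilon> q) \<bullet> x = of_int (level p q)} face_of closed_alcove"
    using assms by (intro face_of_Int_supporting_hyperplane_ge convex_closed_alcove)
      (auto simp: closed_alcove_def)
  then show ?thesis
    by (simp add: tight_def Int_def)
qed

text \<open>For an adjacent pair, \<open>adjacent_point\<close> gives a point at which only this
  inequality is tight; near it the face fills the hyperplane, so it has codimension one. Otherwise a
  residue in between makes the face too small.\<close>

lemma facet_tight_iff_adjacent: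
  assumes pq: "p \<in> {1..l}" "q \<in> {1..l}" "p \<noteq> q"
  shows "{x \<in> closed_alcove. tight x p q} facet_of closed_alcove \<longleftrightarrow> adjacent p q"
proof
  assume adj: "adjacent p q"
  define H where "H = U \<inter> {x. (\<epsilon> p - \<epsilon> q) \<bullet> x = of_int (level p q)}"
  define F where "F = {x \<in> closed_alcove. tight x p q}"
  define W where "W = {x. \<forall>r\<in>{1..l}. \<forall>s\<in>{1..l}. (r, s) \<in> {(r, s). r \<noteq> s \<and> (r, s) \<noteq> (p, q)} \<longrightarrow>
    of_int (level r s) < (\<epsilon> r - \<epsilon> s) \<bullet> x}"
  obtain y where y: "y \<in> closed_alcove" "tight y p q"
    "\<And>r s. r \<in> {1..l} \<Longrightarrow> s \<in> {1..l} \<Longrightarrow> r \<noteq> s \<Longrightarrow> (r, s) \<noteq> (p, q) \<Longrightarrow>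
       of_int (level r s) < (\<epsilon> r - \<epsilon> s) \<bullet> y"
    using adjacent_point[OF pq(1,2) adj] by blast
  have "y \<in> H \<inter> W"
    using y(1,2) y(3) unfolding H_def W_def tight_def closed_alcove_def by blast
  have "open W"
    unfolding W_def by (rule open_strict_pairs)
  have "affine H"
    unfolding H_def by (intro affine_Int affine_U affine_hyperplane)
  have "affine hull (H \<inter> W) = H"
    using affine_hull_affine_Int_open[OF \<open>affine H\<close> \<open>open W\<close>] \<open>y \<in> H \<inter> W\<close>
      affine_hull_eq[THEN iffD2, OF \<open>affine H\<close>] by (metis empty_iff)
  moreover have "H \<inter> W \<subseteq> F"
  proof
    fix x assume x: "x \<in> H \<inter> W"
    have "of_int (level r s) \<le> (\<epsilon> r - \<epsilon> s) \<bullet> x" if "r \<in> {1..l}" "s \<in> {1..l}" "r \<noteq> s" for r s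
      using x that by (cases "(r, s) = (p, q)") (auto simp: H_def W_def less_imp_le)
    then show "x \<in> F"
      using x by (auto simp: H_def F_def tight_def closed_alcove_def)
  qed
  moreover have "F \<subseteq> H"
    by (auto simp: H_def F_def tight_def closed_alcove_def)
  ultimately have "affine hull F = H"
    using hull_mono[of "H \<inter> W" F affine] hull_minimal[of F H affine] \<open>affine H\<close> by simp
  then have "aff_dim F = aff_dim H"
    by (metis aff_dim_affine_hull)
  also have "\<dots> = aff_dim U - 1"
  proof -
    have "a \<in> U" "(\<epsilon> p - \<epsilon> q) \<bullet> a \<noteq> of_int (level p q)"
      using a_in_U level_plus_gap[of p q] gap_pos[OF pq] by auto
    then show ?thesis
      unfolding H_def using aff_dim_affine_Int_hyperplane[OF affine_U, of "\<epsilon> p - \<epsilon> q" "of_int (level p q)"]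
        \<open>y \<in> H \<inter> W\<close> unfolding H_def by auto
  qed
  also have "aff_dim U = aff_dim closed_alcove"
    by (metis affine_hull_closed_alcove aff_dim_affine_hull)
  finally show "F facet_of closed_alcove"
    using face_tight[OF pq] y(1,2) unfolding facet_of_def F_def by auto
next
  define F where "F r = {x \<in> closed_alcove. tight x p r}" for r
  assume "F q facet_of closed_alcove"
  then have facet: "F q face_of closed_alcove" "aff_dim (F q) = aff_dim closed_alcove - 1"
    by (auto simp: facet_of_def)
  show "adjacent p q"
  proof (rule ccontr)
    assume "\<not> adjacent p q"
    have fin: "finite ({1..l} - {p})" "{1..l} - {p} \<noteq> {}"
      using pq by auto
    \<comment> \<open>The residue following that of \<open>p\<close> on the circle: with this choice
      \<open>(p, r)\<close> is adjacent, and \<open>adjacent_point\<close> yields a point of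
      \<open>F r\<close> outside \<open>F q\<close>.\<close>
    define r where "r = arg_min_on (gap p) ({1..l} - {p})"
    have r: "r \<in> {1..l} - {p}" "\<forall>s\<in>{1..l} - {p}. gap p r \<le> gap p s"
      unfolding r_def using arg_min_if_finite[OF fin, of "gap p"] not_le by blast+
    then have "adjacent p r"
      unfolding adjacent_def by blast
    then have "r \<noteq> q"
      using \<open>\<not> adjacent p q\<close> by auto
    then have "gap p r < gap p q"
      using r gap_eq_imp[OF pq, of r] pq by force
    obtain y where y: "y \<in> F r" "y \<notin> F q"
    proof -
      obtain y where "y \<in> closed_alcove" "tight y p r"
        "\<And>s t. s \<in> {1..l} \<Longrightarrow> t \<in> {1..l} \<Longrightarrow> s \<noteq> t \<Longrightarrow> (s, t) \<noteq> (p, r) \<Longrightarrow>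
           of_int (level s t) < (\<epsilon> s - \<epsilon> t) \<bullet> y"
        using adjacent_point[OF pq(1) _ \<open>adjacent p r\<close>] r by blast
      moreover from this(3)[OF pq] have "of_int (level p q) < (\<epsilon> p - \<epsilon> q) \<bullet> y"
        using \<open>r \<noteq> q\<close> by simp
      ultimately show thesis
        using that by (auto simp: F_def tight_def)
    qed
    \<comment> \<open>\<open>F q\<close>, \<open>F r\<close> and the closed alcove form a strictly
      increasing chain of faces, so \<open>F q\<close> has codimension at least two.\<close>
    have "F q \<subseteq> F r"
      using tight_split(1)[OF _ pq _ _ _ \<open>gap p r < gap p q\<close>] r by (auto simp: F_def)
    moreover have Fr: "F r face_of closed_alcove"
      unfolding F_def using face_tight[of p r] pq r by auto
    ultimately have "F q face_of F r"
      using face_of_subset[OF facet(1)] face_of_imp_subset by metis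
    then have "aff_dim (F q) < aff_dim (F r)"
      using face_of_aff_dim_lt[of "F r" "F q"] y Fr face_of_imp_convex by metis
    moreover have "a \<notin> F r"
      using level_plus_gap[of p r] gap_pos[of p r] pq r by (auto simp: F_def tight_def)
    then have "F r \<noteq> closed_alcove"
      using a_in_alcove closure_alcove closure_subset by blast
    then have "aff_dim (F r) < aff_dim closed_alcove"
      using face_of_aff_dim_lt[OF convex_closed_alcove Fr] by simp
    ultimately show False
      using facet(2) by simp
  qed
qed

end

lemma (in type_A) alcoveE:
  assumes "A \<in> alcoves \<epsilon> l"
  obtains a where "alcove_point \<epsilon> l a" "a \<in> A" "A = alcove_point.alcove \<epsilon> l a"
proof -
  obtain a where a: "regular a" "A = connected_component_set {x. regular x} a"
    using assms unfolding alcoves_def complement_of_hyperplanes components_def by auto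
  then interpret alcove_point \<epsilon> l a
    by unfold_locales
  show thesis
    using that alcove_point_axioms a_in_alcove a connected_component_eq_alcove by auto
qed

section \<open>Ceilings and tight pairs\<close>

text \<open>Dominance locates the origin relative to the alcove: all levels of pairs
  \<open>p < q\<close> are nonnegative.\<close>

locale dominant_alcove_point = alcove_point +
  assumes simple_pos: "\<And>t. 1 \<le> t \<Longrightarrow> t < l \<Longrightarrow> 0 < (\<epsilon> t - \<epsilon> (t + 1)) \<bullet> a"
begin

lemma level_nonneg:
  assumes "1 \<le> p" "p < q" "q \<le> l"
  shows "0 \<le> level p q"
  using pos_if_simple_pos[OF simple_pos assms] by (simp add: level_def)

lemma closure_Int_hyperplane:
  "closure alcove \<inter> aff_hyperplane \<epsilon> l (\<epsilon> p - \<epsilon> q) (level p q) = {x \<in> closed_alcove. tight x p q}"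
  unfolding closure_alcove by (auto simp: mem_aff_hyperplane tight_def closed_alcove_def)

lemma closure_Int_hyperplane_flip:
  "closure alcove \<inter> aff_hyperplane \<epsilon> l (\<epsilon> q - \<epsilon> p) (- level p q) = {x \<in> closed_alcove. tight x p q}"
  using closure_Int_hyperplane[of p q] by (simp add: aff_hyperplane_flip[of p q])

text \<open>In terms of the positive root the hyperplane has height \<open>level q p + 1\<close>,
  which is at least 1, so both the alcove and the origin lie strictly below it.\<close>

lemma descent_ceiling:
  assumes "1 \<le> q" "q < p" "p \<le> l" "adjacent p q"
  shows "aff_hyperplane \<epsilon> l (\<epsilon> q - \<epsilon> p) (- level p q) \<in> ceilings \<epsilon> l alcove"
proof -
  have pq: "p \<in> {1..l}" "q \<in> {1..l}" "p \<noteq> q" "q \<noteq> p"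
    using assms by auto
  let ?H = "aff_hyperplane \<epsilon> l (\<epsilon> q - \<epsilon> p) (- level p q)"
  have root: "\<epsilon> q - \<epsilon> p \<in> pos_roots \<epsilon> l"
    using assms unfolding pos_roots_def by blast
  have "(closure alcove \<inter> ?H) facet_of closure alcove"
    unfolding closure_Int_hyperplane_flip unfolding closure_alcove
    using facet_tight_iff_adjacent[OF pq(1-3)] assms(4) by simp
  then have "?H \<in> walls \<epsilon> l alcove"
    using root unfolding walls_def by blast
  moreover have level: "- level p q = level q p + 1"
    using level_flip[OF pq(2,1,4)] by simp
  moreover have "0 \<le> level q p"
    using assms by (intro level_nonneg) auto
  ultimately show ?thesis
    using root alcove_upper_bound[OF _ pq(2,1,4)] unfolding ceilings_def
    by (intro CollectI exI[of _ "\<epsilon> q - \<epsilon> p"] exI[of _ "- level p q"])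
      (auto simp: mem_aff_hyperplane)
qed

text \<open>The wall lies between the origin and the alcove, so the segment from the origin to \<open>a\<close>
  crosses it.\<close>

lemma ascent_not_ceiling:
  assumes "1 \<le> p" "p < q" "q \<le> l"
  shows "aff_hyperplane \<epsilon> l (\<epsilon> p - \<epsilon> q) (level p q) \<notin> ceilings \<epsilon> l alcove" (is "?H \<notin> _")
proof
  have pq: "p \<in> {1..l}" "q \<in> {1..l}" "p \<noteq> q"
    using assms by auto
  assume "?H \<in> ceilings \<epsilon> l alcove"
  \<comment> \<open>The ceiling condition provides some root and height presenting the same set,
    possibly other than the given ones; the argument therefore uses only that the two hyperplanes
    coincide as sets.\<close>
  then obtain \<alpha> m where H: "?H = aff_hyperplane \<epsilon> l \<alpha> m" and "0 \<notin> aff_hyperplane \<epsilon> l \<alpha> m"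
    and "\<forall>x\<in>alcove. \<alpha> \<bullet> x < of_int m \<longleftrightarrow> \<alpha> \<bullet> 0 < of_int m"
    unfolding ceilings_def by blast
  then have side: "\<alpha> \<bullet> a < of_int m \<longleftrightarrow> 0 < m" and "m \<noteq> 0"
    using a_in_alcove zero_in_U by (auto simp: aff_hyperplane_def)
  have "level p q \<noteq> 0"
    using \<open>0 \<notin> aff_hyperplane \<epsilon> l \<alpha> m\<close> zero_in_U unfolding H[symmetric]
    by (auto simp: mem_aff_hyperplane)
  then have level: "0 < real_of_int (level p q)"
    using level_nonneg[OF assms] by simp
  have less: "of_int (level p q) < (\<epsilon> p - \<epsilon> q) \<bullet> a"
    using level_plus_gap[of p q] gap_pos[OF pq] by simp
  define t where "t = of_int (level p q) / ((\<epsilon> p - \<epsilon> q) \<bullet> a)"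
  have t: "0 < t" "t < 1"
    using level less by (auto simp: t_def)
  have "t *\<^sub>R a \<in> U"
    using a_in_U by (simp add: mem_U_iff flip: sum_distrib_left)
  then have "t *\<^sub>R a \<in> ?H"
    using level less by (simp add: mem_aff_hyperplane t_def)
  then have ta: "t * (\<alpha> \<bullet> a) = of_int m"
    unfolding H by (simp add: aff_hyperplane_def)
  show False
  proof (cases "0 < m")
    case True
    then have "0 < \<alpha> \<bullet> a"
      using ta t by (metis of_int_0_less_iff zero_less_mult_pos)
    then have "t * (\<alpha> \<bullet> a) < \<alpha> \<bullet> a"
      using t by simp
    then show False
      using True side ta by simp
  next
    case False
    then have "m < 0" "of_int m \<le> \<alpha> \<bullet> a"
      using side \<open>m \<noteq> 0\<close> by auto
    then have "\<alpha> \<bullet> a < 0"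
      using ta t by (metis mult_less_0_iff of_int_less_0_iff order_less_asym)
    then have "\<alpha> \<bullet> a < t * (\<alpha> \<bullet> a)"
      using t by simp
    then show False
      using \<open>of_int m \<le> \<alpha> \<bullet> a\<close> ta by simp
  qed
qed

section \<open>Tight pairs at points of the upper closure\<close>

lemma upper_closure_subset: "upper_closure \<epsilon> l alcove \<subseteq> closed_alcove"
  unfolding upper_closure_def closure_alcove[symmetric] using closure_subset by blast

lemma upper_closure_disjoint_floors:
  assumes "y \<in> upper_closure \<epsilon> l alcove" "H \<in> walls \<epsilon> l alcove" "y \<in> H"
  shows "H \<in> ceilings \<epsilon> l alcove"
proof -
  obtain \<alpha> m where "\<alpha> \<in> pos_roots \<epsilon> l" "H = aff_hyperplane \<epsilon> l \<alpha> m"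
    using assms(2) unfolding walls_def by blast
  then have "\<not> regular y"
    using assms(3) complement_of_hyperplanes by blast
  then have "y \<notin> alcove"
    using regular_if_in_alcove by blast
  then show ?thesis
    using assms unfolding upper_closure_def by blast
qed

text \<open>A tight adjacent ascent would put \<open>y\<close> on a wall that is not a ceiling,
  which the upper closure avoids. Any other tight pair splits at an intermediate residue into two
  tight pairs with smaller gaps, and descents compose.\<close>

lemma tight_imp_descent:
  assumes y: "y \<in> upper_closure \<epsilon> l alcove"
    and "p \<in> {1..l}" "q \<in> {1..l}" "p \<noteq> q" "tight y p q"
  shows "q < p"
  using assms(2-)
\<comment> \<open>Gaps are real numbers, so the number of pairs with a smaller gap serves as the
  induction measure.\<close>
proof (induction "card {(r, s). r \<in> {1..l} \<and> s \<in> {1..l} \<and> gap r s < gap p q}" arbitrary: p q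
    rule: less_induct)
  case less
  have y': "y \<in> closed_alcove"
    using y upper_closure_subset by blast
  show ?case
  proof (cases "adjacent p q")
    case True
    show ?thesis
    proof (rule ccontr)
      assume "\<not> q < p"
      then have lt: "1 \<le> p" "p < q" "q \<le> l"
        using less.prems by auto
      then have root: "\<epsilon> p - \<epsilon> q \<in> pos_roots \<epsilon> l"
        unfolding pos_roots_def by blast
      let ?H = "aff_hyperplane \<epsilon> l (\<epsilon> p - \<epsilon> q) (level p q)"
      have "(closure alcove \<inter> ?H) facet_of closure alcove"
        unfolding closure_Int_hyperplane unfolding closure_alcove
        using facet_tight_iff_adjacent[OF less.prems(1-3)] True by simp
      then have "?H \<in> walls \<epsilon> l alcove"
        using root unfolding walls_def by blast
      moreover have "y \<in> ?H"
        using less.prems(4) y' by (simp add: mem_aff_hyperplane tight_def closed_alcove_def)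
      ultimately show False
        using upper_closure_disjoint_floors[OF y] ascent_not_ceiling[OF lt] by blast
    qed
  next
    case False
    then obtain r where r: "r \<in> {1..l}" "r \<noteq> p" "gap p r < gap p q"
      using less.prems(3) unfolding adjacent_def by fastforce
    note split = split_pair[OF less.prems(1-3) r]
    have smaller: "card {(r', s'). r' \<in> {1..l} \<and> s' \<in> {1..l} \<and> gap r' s' < gap u v}
      < card {(r', s'). r' \<in> {1..l} \<and> s' \<in> {1..l} \<and> gap r' s' < gap p q}"
      if "u \<in> {1..l}" "v \<in> {1..l}" "gap u v < gap p q" for u v
    proof (rule psubset_card_mono)
      show "finite {(r', s'). r' \<in> {1..l} \<and> s' \<in> {1..l} \<and> gap r' s' < gap p q}"
        by (rule finite_subset[of _ "{1..l} \<times> {1..l}"]) auto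
      have "(u, v) \<in> {(r', s'). r' \<in> {1..l} \<and> s' \<in> {1..l} \<and> gap r' s' < gap p q}"
        "(u, v) \<notin> {(r', s'). r' \<in> {1..l} \<and> s' \<in> {1..l} \<and> gap r' s' < gap u v}"
        using that by auto
      moreover have "{(r', s'). r' \<in> {1..l} \<and> s' \<in> {1..l} \<and> gap r' s' < gap u v}
        \<subseteq> {(r', s'). r' \<in> {1..l} \<and> s' \<in> {1..l} \<and> gap r' s' < gap p q}"
        using that(3) by auto
      ultimately show "{(r', s'). r' \<in> {1..l} \<and> s' \<in> {1..l} \<and> gap r' s' < gap u v}
        \<subset> {(r', s'). r' \<in> {1..l} \<and> s' \<in> {1..l} \<and> gap r' s' < gap p q}"
        by blast
    qed
    have "gap r q < gap p q"
      using split(3) gap_pos[of p r] less.prems r by auto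
    note tight = tight_split[OF y' less.prems r]
    have "r < p"
      using less.hyps[OF smaller, of p r] less.prems r tight by blast
    moreover have "q < r"
      using less.hyps[OF smaller, of r q] less.prems r tight split(1) \<open>gap r q < gap p q\<close> by blast
    ultimately show ?thesis by simp
  qed
qed

text \<open>Subdivide a tight pair at an intermediate residue and keep a half that is an edge;
  umbrella-freeness provides one until the pair is adjacent. The whole set \<open>W\<close> is
  carried along because one ceiling has to contain all of it.\<close>

lemma umbrella_free_ceiling:
  assumes uf: "umbrella_free l (\<lambda>i j. {i, j} \<in> E)"
    and W: "W \<subseteq> upper_closure \<epsilon> l alcove" "W \<noteq> {}"
    and "1 \<le> q" "q < p" "p \<le> l" "{q, p} \<in> E" "\<And>x. x \<in> W \<Longrightarrow> tight x p q"
  shows "\<exists>p q. 1 \<le> q \<and> q < p \<and> p \<le> l \<and> {q, p} \<in> E \<and> adjacent p q \<and> (\<forall>x\<in>W. tight x p q)"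
  using assms(4-)
proof (induction "p - q" arbitrary: p q rule: less_induct)
  case less
  show ?case
  proof (cases "adjacent p q")
    case True
    then show ?thesis
      using less.prems by blast
  next
    case False
    have pq: "p \<in> {1..l}" "q \<in> {1..l}" "p \<noteq> q"
      using less.prems by auto
    obtain r where r: "r \<in> {1..l}" "r \<noteq> p" "gap p r < gap p q"
      using pq(3) False unfolding adjacent_def by fastforce
    have tight: "tight x p r" "tight x r q" if "x \<in> W" for x
      using tight_split[OF _ pq less.prems(5)[OF that] r] W(1) upper_closure_subset that by blast+
    obtain y where "y \<in> W" using W(2) by blast
    then have "r < p" "q < r"
      using tight_imp_descent[of y] tight[of y] W(1) pq r split_pair(1)[OF pq r] by blast+
    then have "{q, r} \<in> E \<or> {r, p} \<in> E"
      using uf less.prems unfolding umbrella_free_def by blast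
    then show ?thesis
    proof
      assume "{q, r} \<in> E"
      then show ?thesis
        using \<open>r < p\<close> \<open>q < r\<close> less.prems tight by (intro less.hyps[of r q]) auto
    next
      assume "{r, p} \<in> E"
      then show ?thesis
        using \<open>r < p\<close> \<open>q < r\<close> less.prems tight by (intro less.hyps[of p r]) auto
    qed
  qed
qed

text \<open>No ascent is tight on the upper closure, so the hyperplane can meet it only through the
  tight pair \<open>(j, i)\<close>; subdividing that pair leads to the required ceiling.\<close>

lemma umbrella_free_compatible_at:
  assumes uf: "umbrella_free l (\<lambda>i j. {i, j} \<in> E)"
    and ij: "1 \<le> i" "i < j" "j \<le> l" "{i, j} \<in> E"
    and y: "y \<in> upper_closure \<epsilon> l alcove \<inter> aff_hyperplane \<epsilon> l (\<epsilon> i - \<epsilon> j) m" (is "y \<in> ?W")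
  shows "\<exists>\<beta>\<in>graph_roots \<epsilon> E. \<exists>m'. aff_hyperplane \<epsilon> l \<beta> m' \<in> ceilings \<epsilon> l alcove \<and>
    ?W \<subseteq> aff_hyperplane \<epsilon> l \<beta> m'"
proof -
  have ij': "i \<in> {1..l}" "j \<in> {1..l}" "i \<noteq> j"
    using ij by auto
  have "tight x j i" if "x \<in> ?W" for x
  proof -
    have x: "x \<in> upper_closure \<epsilon> l alcove" "(\<epsilon> i - \<epsilon> j) \<bullet> x = of_int m"
      using that by (auto simp: mem_aff_hyperplane)
    then have "x \<in> closed_alcove"
      using upper_closure_subset by blast
    then show ?thesis
      using tight_imp_descent[OF x(1) ij'] ij(2) by (elim tight_cases[OF _ ij' x(2)]) auto
  qed
  then obtain p q where pq: "1 \<le> q" "q < p" "p \<le> l" "{q, p} \<in> E" "adjacent p q"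
    "\<forall>x\<in>?W. tight x p q"
    using umbrella_free_ceiling[OF uf, of ?W i j] ij y by blast
  have "?W \<subseteq> aff_hyperplane \<epsilon> l (\<epsilon> q - \<epsilon> p) (- level p q)"
  proof
    fix x assume "x \<in> ?W"
    then have "tight x p q" "x \<in> U"
      using pq(6) by (auto simp: mem_aff_hyperplane)
    then show "x \<in> aff_hyperplane \<epsilon> l (\<epsilon> q - \<epsilon> p) (- level p q)"
      by (simp add: aff_hyperplane_flip[symmetric] mem_aff_hyperplane tight_def)
  qed
  moreover have "\<epsilon> q - \<epsilon> p \<in> graph_roots \<epsilon> E"
    using pq unfolding graph_roots_def by blast
  ultimately show ?thesis
    using descent_ceiling[OF pq(1-3,5)] by blast
qed

end

section \<open>Compatibility and umbrellas\<close>

lemma frac_of_small: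
  fixes x :: real
  shows "0 \<le> x \<Longrightarrow> x < 1 \<Longrightarrow> frac x = x" "- 1 \<le> x \<Longrightarrow> x < 0 \<Longrightarrow> frac x = x + 1"
  using frac_eq[of x] frac_eq[of "x + 1"] frac_1_eq[of x] by auto

context type_A
begin

lemma umbrella_free_imp_compatible:
  assumes E: "E \<subseteq> all_pairs {1..l}" and uf: "umbrella_free l (\<lambda>i j. {i, j} \<in> E)"
  shows "worpitzky_compatible \<epsilon> l (graph_roots \<epsilon> E)"
  unfolding worpitzky_compatible_def
proof (intro conjI ballI impI allI)
  show "graph_roots \<epsilon> E \<subseteq> pos_roots \<epsilon> l"
    using E unfolding graph_roots_def pos_roots_def all_pairs_def by fastforce
next
  fix A \<alpha> and m :: int
  assume A: "A \<in> alcoves \<epsilon> l" "A \<subseteq> fundamental_parallelepiped \<epsilon> l" and "\<alpha> \<in> graph_roots \<epsilon> E"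
  then obtain i j where ij: "{i, j} \<in> E" "i < j" "\<alpha> = \<epsilon> i - \<epsilon> j"
    unfolding graph_roots_def by blast
  then have "1 \<le> i" "j \<le> l"
    using E by (auto simp: all_pairs_def)
  obtain a where a: "alcove_point \<epsilon> l a" "a \<in> A" "A = alcove_point.alcove \<epsilon> l a"
    using alcoveE[OF A(1)] by blast
  have "dominant_alcove_point \<epsilon> l a"
    using a A(2) unfolding dominant_alcove_point_def dominant_alcove_point_axioms_def
    by (auto simp: fundamental_parallelepiped_def simple_root_def)
  then interpret dominant_alcove_point \<epsilon> l a .
  show "upper_closure \<epsilon> l A \<inter> aff_hyperplane \<epsilon> l \<alpha> m = {} \<or>
    (\<exists>\<beta>\<in>graph_roots \<epsilon> E. \<exists>m'. aff_hyperplane \<epsilon> l \<beta> m' \<in> ceilings \<epsilon> l A \<and>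
      upper_closure \<epsilon> l A \<inter> aff_hyperplane \<epsilon> l \<alpha> m \<subseteq> aff_hyperplane \<epsilon> l \<beta> m')"
    using umbrella_free_compatible_at[OF uf \<open>1 \<le> i\<close> ij(2) \<open>j \<le> l\<close> ij(1)] unfolding a(3) ij(3) by blast
qed

text \<open>Any prescribed residues modulo 1 occur at a point of the fundamental parallelepiped: let
  consecutive coordinates differ by the fractional part of the prescribed difference.\<close>

lemma point_with_residues:
  assumes b: "inj_on b {1..l}" "\<And>t. t \<in> {1..l} \<Longrightarrow> 0 \<le> b t \<and> b t < (1::real)"
  obtains a where "dominant_alcove_point \<epsilon> l a"
    "\<And>p q. p \<in> {1..l} \<Longrightarrow> q \<in> {1..l} \<Longrightarrow> alcove_point.gap \<epsilon> a p q = frac (b p - b q)"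
    "alcove_point.alcove \<epsilon> l a \<subseteq> fundamental_parallelepiped \<epsilon> l"
proof -
  \<comment> \<open>Suffix sums, so that \<open>s t - s (t + 1)\<close> is the wanted consecutive
    difference.\<close>
  define s where "s t = (\<Sum>u=t..<l. frac (b u - b (u + 1)))" for t
  define a where "a = of_coords s"
  have s: "s t = frac (b t - b (t + 1)) + s (t + 1)" if "t < l" for t
    using that by (simp add: s_def sum.atLeast_Suc_lessThan)
  \<comment> \<open>Passing to fractional parts changes each consecutive difference by an integer,
    so \<open>s\<close> and \<open>b\<close> agree modulo 1 up to the common shift
    \<open>b l\<close>.\<close>
  have resid: "s t - (b t - b l) \<in> \<int>" if "t \<le> l" for t
    using that
  proof (induction t rule: inc_induct)
    case base
    then show ?case by (simp add: s_def)
  next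
    case (step t)
    have "s t - (b t - b l) = (s (Suc t) - (b (Suc t) - b l)) - of_int \<lfloor>b t - b (t + 1)\<rfloor>"
      using s[of t] step by (simp add: frac_def)
    then show ?case
      using step by (simp only: Ints_diff Ints_of_int)
  qed
  have diff: "(\<epsilon> p - \<epsilon> q) \<bullet> a - (b p - b q) \<in> \<int>" if "p \<in> {1..l}" "q \<in> {1..l}" for p q
  proof -
    have "(\<epsilon> p - \<epsilon> q) \<bullet> a - (b p - b q) = (s p - (b p - b l)) - (s q - (b q - b l))"
      using that by (simp only: a_def diff_of_coords)
    then show ?thesis
      using that resid[of p] resid[of q] by (simp only: Ints_diff atLeastAtMost_iff)
  qed
  have nonint: "b p - b q \<notin> \<int>" if "p \<in> {1..l}" "q \<in> {1..l}" "p \<noteq> q" for p q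
  proof
    assume "b p - b q \<in> \<int>"
    then obtain k where k: "b p - b q = of_int k" by (elim Ints_cases)
    have "- 1 < real_of_int k" "real_of_int k < 1"
      using b(2)[OF that(1)] b(2)[OF that(2)] k by linarith+
    then have "k = 0" by linarith
    then show False
      using k inj_onD[OF b(1) _ that(1,2)] that(3) by simp
  qed
  have "regular a"
    unfolding regular_def
  proof (intro conjI ballI impI)
    show "a \<in> U" by (simp add: a_def of_coords_in_U)
    fix p q assume pq: "p \<in> {1..l}" "q \<in> {1..l}" "p \<noteq> q"
    show "(\<epsilon> p - \<epsilon> q) \<bullet> a \<notin> \<int>"
    proof
      assume "(\<epsilon> p - \<epsilon> q) \<bullet> a \<in> \<int>"
      then have "(\<epsilon> p - \<epsilon> q) \<bullet> a - ((\<epsilon> p - \<epsilon> q) \<bullet> a - (b p - b q)) \<in> \<int>"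
        using diff[OF pq(1,2)] by (rule Ints_diff)
      then show False
        using nonint[OF pq] by simp
    qed
  qed
  then interpret alcove_point \<epsilon> l a
    by unfold_locales
  have simple: "(\<epsilon> t - \<epsilon> (t + 1)) \<bullet> a = frac (b t - b (t + 1))" if "1 \<le> t" "t < l" for t
    using that s[of t] diff_of_coords[of t "t + 1" s] unfolding a_def by simp
  have simple_pos: "0 < (\<epsilon> t - \<epsilon> (t + 1)) \<bullet> a" if "1 \<le> t" "t < l" for t
    using simple[OF that] nonint[of t "t + 1"] that by auto
  have "dominant_alcove_point \<epsilon> l a"
    using simple_pos by unfold_locales
  moreover have "gap p q = frac (b p - b q)" if pq: "p \<in> {1..l}" "q \<in> {1..l}" for p q
  proof -
    obtain k where "(\<epsilon> p - \<epsilon> q) \<bullet> a - (b p - b q) = of_int k"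
      using diff[OF pq] by (elim Ints_cases)
    then have "(\<epsilon> p - \<epsilon> q) \<bullet> a = (b p - b q) + of_int k"
      by simp
    then show ?thesis
      by (simp add: gap_def frac_def)
  qed
  moreover have "alcove \<subseteq> fundamental_parallelepiped \<epsilon> l"
  proof
    fix x assume x: "x \<in> alcove"
    have "0 < (\<epsilon> t - \<epsilon> (t + 1)) \<bullet> x \<and> (\<epsilon> t - \<epsilon> (t + 1)) \<bullet> x \<le> 1" if t: "1 \<le> t" "t < l" for t
    proof -
      \<comment> \<open>With level 0 for every simple root, the bounds defining the alcove place all
        of it between 0 and 1.\<close>
      have "level t (t + 1) = 0"
        using simple[OF t] frac_lt_1 frac_ge_0 by (simp add: level_def floor_eq_iff)
      then have "0 < (\<epsilon> t - \<epsilon> (t + 1)) \<bullet> x"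
        using alcove_lower_bound[OF x, of t "t + 1"] t by simp
      moreover have "(\<epsilon> t - \<epsilon> (t + 1)) \<bullet> x < 1"
        using alcove_upper_bound[OF x, of t "t + 1"] t \<open>level t (t + 1) = 0\<close> by simp
      ultimately show ?thesis by simp
    qed
    then show "x \<in> fundamental_parallelepiped \<epsilon> l"
      using x unfolding fundamental_parallelepiped_def simple_root_def alcove_def by blast
  qed
  ultimately show thesis
    using that by blast
qed

text \<open>An umbrella \<open>i < k < j\<close> is detected by an alcove whose residues decrease from \<open>j\<close> to \<open>k\<close>
  to \<open>i\<close> without anything in between, at a point where these three residues are merged.\<close>

lemma compatible_imp_umbrella_free:
  assumes E: "E \<subseteq> all_pairs {1..l}" and comp: "worpitzky_compatible \<epsilon> l (graph_roots \<epsilon> E)"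
  shows "umbrella_free l (\<lambda>i j. {i, j} \<in> E)"
  unfolding umbrella_free_def
proof (intro allI impI)
  fix i k j
  assume ikj: "1 \<le> i" "i < k" "k < j" "j \<le> l" "{i, j} \<in> E"
  \<comment> \<open>\<open>4 * \<delta>\<close> is the spacing \<open>1 / (l + 1)\<close> of the
    remaining residues. The residues \<open>0\<close>, \<open>\<delta>\<close>,
    \<open>2 * \<delta>\<close> of \<open>i\<close>, \<open>k\<close>, \<open>j\<close> are thus
    consecutive; \<open>c\<close> holds the residues after merging these three, and \<open>w\<close>
    the amounts removed.\<close>
  define \<delta> :: real where "\<delta> = 1 / (4 * (real l + 1))"
  define w where "w t = (if t = j then 2 * \<delta> else if t = k then \<delta> else 0)" for t
  define c where "c t = (if t \<in> {i, k, j} then 0 else real t / (real l + 1))" for t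
  define b where "b t = c t + w t" for t
  have "0 < \<delta>" by (simp add: \<delta>_def)
  have c_bounds: "4 * \<delta> \<le> c t" "c t \<le> 1 - 4 * \<delta>" if "t \<in> {1..l}" "t \<notin> {i, k, j}" for t
  proof -
    have "4 * \<delta> = 1 / (real l + 1)" "1 - 4 * \<delta> = real l / (real l + 1)"
      by (simp_all add: \<delta>_def field_simps)
    then show "4 * \<delta> \<le> c t" "c t \<le> 1 - 4 * \<delta>"
      using that by (simp_all add: c_def divide_right_mono)
  qed
  have c0: "c t = 0" "w t \<le> 2 * \<delta>" if "t \<in> {i, k, j}" for t
    using that \<open>0 < \<delta>\<close> by (auto simp: c_def w_def)
  have w0: "w t = 0" if "t \<notin> {i, k, j}" for t
    using that by (auto simp: w_def)
  have w_nonneg: "0 \<le> w t" for t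
    using \<open>0 < \<delta>\<close> by (simp add: w_def)
  have "4 * \<delta> < 1"
    using ikj by (simp add: \<delta>_def)
  have c_range: "0 \<le> c t" "c t < 1" if "t \<in> {1..l}" for t
    using c_bounds[OF that] c0(1)[of t] \<open>0 < \<delta>\<close> by (cases "t \<in> {i, k, j}"; simp)+
  have b_range: "0 \<le> b t \<and> b t < 1" if "t \<in> {1..l}" for t
    using c_bounds[OF that] c0[of t] w0[of t] w_nonneg[of t] \<open>0 < \<delta>\<close> \<open>4 * \<delta> < 1\<close>
    by (cases "t \<in> {i, k, j}") (auto simp: b_def)
  \<comment> \<open>The pairs intended to become tight. Outside \<open>T\<close>, merging keeps
    residues in strict order, as \<open>c_less\<close> records.\<close>
  define T where "T = {(j, k), (k, i), (j, i)}"
  have c_less: "c q < c p" if "p \<in> {1..l}" "q \<in> {1..l}" "p \<noteq> q" "(p, q) \<notin> T" "b q \<le> b p" for p q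
  proof (cases "q \<in> {i, k, j}")
    case True
    then have "p \<notin> {i, k, j}"
      using that ikj \<open>0 < \<delta>\<close> by (auto simp: T_def b_def c_def w_def)
    then show ?thesis
      using c_bounds[OF that(1)] c0[OF True] \<open>0 < \<delta>\<close> by simp
  next
    case False
    then have "p \<notin> {i, k, j}"
      using that c_bounds[OF that(2)] c0[of p] w0[of q] \<open>0 < \<delta>\<close> by (auto simp: b_def)
    then have "b p = real p / (real l + 1)" "b q = real q / (real l + 1)" "c p = b p" "c q = b q"
      using False by (simp_all add: b_def w0 c_def)
    then show ?thesis
      using that by (simp add: divide_right_mono divide_strict_right_mono divide_le_cancel)
  qed
  have "inj_on b {1..l}"
  proof (rule inj_onI, rule ccontr)
    fix p q assume pq: "p \<in> {1..l}" "q \<in> {1..l}" "b p = b q" "p \<noteq> q"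
    have "w p \<noteq> w q" if "(p, q) \<in> T \<or> (q, p) \<in> T"
      using that ikj \<open>0 < \<delta>\<close> by (auto simp: T_def w_def)
    moreover have "c p = 0 \<and> c q = 0" if "(p, q) \<in> T \<or> (q, p) \<in> T"
      using that by (auto simp: T_def c_def)
    ultimately have "(p, q) \<notin> T" "(q, p) \<notin> T"
      using pq(3) by (auto simp: b_def)
    then show False
      using c_less[of p q] c_less[of q p] pq by auto
  qed
  then obtain a where "dominant_alcove_point \<epsilon> l a"
    and gap: "\<And>p q. p \<in> {1..l} \<Longrightarrow> q \<in> {1..l} \<Longrightarrow> alcove_point.gap \<epsilon> a p q = frac (b p - b q)"
    and par: "alcove_point.alcove \<epsilon> l a \<subseteq> fundamental_parallelepiped \<epsilon> l"
    using point_with_residues[of b] b_range by blast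
  then interpret dominant_alcove_point \<epsilon> l a by simp
  have in_l: "i \<in> {1..l}" "k \<in> {1..l}" "j \<in> {1..l}"
    using ikj by auto
  have gap_eq: "gap p q = (if b q \<le> b p then b p - b q else b p - b q + 1)"
    if "p \<in> {1..l}" "q \<in> {1..l}" for p q
    using gap[OF that] b_range[OF that(1)] b_range[OF that(2)] by (simp add: frac_of_small)
  have gap_T: "gap p q = w p - w q" if "(p, q) \<in> T" for p q
  proof -
    have "p \<in> {1..l}" "q \<in> {1..l}" "c p = 0" "c q = 0" "w q \<le> w p"
      using that ikj \<open>0 < \<delta>\<close> by (auto simp: T_def c_def w_def)
    then show ?thesis
      by (simp add: gap_eq b_def)
  qed
  have gap_gt: "w p - w q < gap p q" if "p \<in> {1..l}" "q \<in> {1..l}" "p \<noteq> q" "(p, q) \<notin> T" for p q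
    using gap_eq[OF that(1,2)] c_less[OF that] c_range[OF that(1)] c_range[OF that(2)]
    by (auto simp: b_def)
  \<comment> \<open>Subtracting \<open>w\<close> merges the three residues. The slack of
    \<open>(p, q)\<close> becomes \<open>gap p q - (w p - w q)\<close>, which is zero on
    \<open>T\<close> and positive for all other pairs.\<close>
  define y where "y = of_coords (\<lambda>t. \<epsilon> t \<bullet> a - w t)"
  have y_eq: "(\<epsilon> p - \<epsilon> q) \<bullet> y = of_int (level p q) + gap p q - (w p - w q)"
    if "p \<in> {1..l}" "q \<in> {1..l}" for p q
    using level_plus_gap[of p q] unfolding y_def diff_of_coords[OF that] by (simp add: inner_diff_left)
  have "y \<in> U"
    by (simp add: y_def of_coords_in_U)
  have tight: "tight y p q \<longleftrightarrow> (p, q) \<in> T" if "p \<in> {1..l}" "q \<in> {1..l}" "p \<noteq> q" for p q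
    using y_eq[OF that(1,2)] gap_T[of p q] gap_gt[OF that] by (cases "(p, q) \<in> T") (auto simp: tight_def)
  have "y \<in> closed_alcove"
    unfolding closed_alcove_def
  proof (intro CollectI conjI ballI impI \<open>y \<in> U\<close>)
    fix p q assume pq: "p \<in> {1..l}" "q \<in> {1..l}" "p \<noteq> q"
    show "of_int (level p q) \<le> (\<epsilon> p - \<epsilon> q) \<bullet> y"
      using y_eq[OF pq(1,2)] gap_T[of p q] gap_gt[OF pq] by fastforce
  qed
  have T_descent: "q < p" if "(p, q) \<in> T" for p q
    using that ikj by (auto simp: T_def)
  have integral_at_y: "(q, p) \<in> T \<and> m = - level q p"
    if pq: "1 \<le> p" "p < q" "q \<le> l" and H: "y \<in> aff_hyperplane \<epsilon> l (\<epsilon> p - \<epsilon> q) m" for p q m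
  proof -
    have pq': "p \<in> {1..l}" "q \<in> {1..l}" "p \<noteq> q" "q \<noteq> p"
      using pq by auto
    have "(\<epsilon> p - \<epsilon> q) \<bullet> y = of_int m"
      using H by (simp add: mem_aff_hyperplane)
    then show ?thesis
      using tight[OF pq'(1-3)] tight[OF pq'(2,1,4)] T_descent[of p q] pq
      by (elim tight_cases[OF \<open>y \<in> closed_alcove\<close> pq'(1-3)]) auto
  qed
  have facet_adjacent: "adjacent q p"
    if pq: "1 \<le> p" "p < q" "q \<le> l"
      and H: "(closure alcove \<inter> aff_hyperplane \<epsilon> l (\<epsilon> p - \<epsilon> q) (- level q p)) facet_of closure alcove"
    for p q
    using H pq facet_tight_iff_adjacent[of q p]
    unfolding closure_Int_hyperplane_flip unfolding closure_alcove by auto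
  have "adjacent j k"
    unfolding adjacent_def
  proof (intro conjI ballI impI)
    fix r assume r: "r \<in> {1..l}" "r \<noteq> j"
    show "gap j k \<le> gap j r"
    proof (cases "(j, r) \<in> T")
      case True
      then show ?thesis
        using gap_T[of j k] gap_T[of j r] \<open>0 < \<delta>\<close> ikj by (auto simp: T_def w_def)
    next
      case False
      then have "w r \<le> w k"
        using r \<open>0 < \<delta>\<close> by (auto simp: w_def T_def)
      then show ?thesis
        using gap_gt[of j r] False gap_T[of j k] r in_l by (auto simp: T_def)
    qed
  qed (use ikj in auto)
  then have ceil: "aff_hyperplane \<epsilon> l (\<epsilon> k - \<epsilon> j) (- level j k) \<in> ceilings \<epsilon> l alcove"
    using descent_ceiling[of k j] ikj by simp
  have tightD: "y \<in> aff_hyperplane \<epsilon> l (\<epsilon> q - \<epsilon> p) (- level p q)" if "(p, q) \<in> T" for p q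
  proof -
    have "p \<in> {1..l}" "q \<in> {1..l}" "p \<noteq> q"
      using that ikj by (auto simp: T_def)
    then have "tight y p q"
      using tight that by blast
    then show ?thesis
      using \<open>y \<in> U\<close> by (simp add: aff_hyperplane_flip[symmetric] mem_aff_hyperplane tight_def)
  qed
  \<comment> \<open>Every wall through \<open>y\<close> comes from a pair in \<open>T\<close>, which
    is a descent, and is therefore a ceiling; the ceiling of \<open>(j, k)\<close> shows that there
    is at least one.\<close>
  have "y \<in> upper_closure \<epsilon> l alcove"
  proof -
    have "H \<in> ceilings \<epsilon> l alcove" if H: "H \<in> walls \<epsilon> l alcove" "y \<in> H" for H
    proof -
      obtain p q m where pq: "1 \<le> p" "p < q" "q \<le> l" "H = aff_hyperplane \<epsilon> l (\<epsilon> p - \<epsilon> q) m"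
        and facet: "(closure alcove \<inter> H) facet_of closure alcove"
        using H(1) unfolding walls_def pos_roots_def by blast
      have "m = - level q p"
        using integral_at_y[OF pq(1-3)] H(2) pq(4) by blast
      then show ?thesis
        using facet_adjacent[OF pq(1-3)] facet descent_ceiling[OF pq(1-3)] pq(4) by blast
    qed
    moreover have "y \<in> closure alcove"
      using \<open>y \<in> closed_alcove\<close> closure_alcove by simp
    moreover have "y \<in> aff_hyperplane \<epsilon> l (\<epsilon> k - \<epsilon> j) (- level j k)"
      by (rule tightD) (simp add: T_def)
    ultimately show ?thesis
      using ceil unfolding upper_closure_def by blast
  qed
  moreover have "y \<in> aff_hyperplane \<epsilon> l (\<epsilon> i - \<epsilon> j) (- level j i)"
    by (rule tightD) (simp add: T_def)
  moreover have "\<epsilon> i - \<epsilon> j \<in> graph_roots \<epsilon> E"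
    using ikj unfolding graph_roots_def by fastforce
  \<comment> \<open>Compatibility must supply a ceiling through \<open>y\<close> whose root is in
    the graph; by \<open>integral_at_y\<close> it belongs to a pair in \<open>T\<close>.\<close>
  ultimately obtain \<beta> m where \<beta>: "\<beta> \<in> graph_roots \<epsilon> E"
    "aff_hyperplane \<epsilon> l \<beta> m \<in> ceilings \<epsilon> l alcove" "y \<in> aff_hyperplane \<epsilon> l \<beta> m"
    using comp alcove_in_alcoves par unfolding worpitzky_compatible_def by blast
  then obtain p q where pq: "{p, q} \<in> E" "p < q" "\<beta> = \<epsilon> p - \<epsilon> q"
    unfolding graph_roots_def by blast
  then have "1 \<le> p" "q \<le> l"
    using E by (auto simp: all_pairs_def)
  then have T: "(q, p) \<in> T" and m: "m = - level q p"
    using integral_at_y[OF _ pq(2)] \<beta>(3) pq(3) by blast+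
  have "(closure alcove \<inter> aff_hyperplane \<epsilon> l \<beta> m) facet_of closure alcove"
    using \<beta>(2) unfolding ceilings_def walls_def by auto
  then have "adjacent q p"
    using facet_adjacent \<open>1 \<le> p\<close> \<open>q \<le> l\<close> pq(2,3) m by blast
  \<comment> \<open>The residue of \<open>k\<close> separates those of \<open>j\<close> and
    \<open>i\<close>, so \<open>(j, i)\<close> gives no facet and only the pairs
    \<open>(j, k)\<close> and \<open>(k, i)\<close> remain.\<close>
  moreover have "gap j k < gap j i"
    using gap_T[of j k] gap_T[of j i] \<open>0 < \<delta>\<close> ikj by (auto simp: T_def w_def)
  then have "\<not> adjacent j i"
    using in_l ikj unfolding adjacent_def by fastforce
  ultimately show "{i, k} \<in> E \<or> {k, j} \<in> E"
    using T pq(1) by (auto simp: T_def)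
qed

end

section \<open>Relabelling a graph and combining the equivalences\<close>

lemma pair_mem_relabelled:
  assumes "E \<subseteq> all_pairs V" "\<And>x. x \<in> V \<Longrightarrow> v (f x) = x" "f (v i) = i" "f (v j) = j"
  shows "{i, j} \<in> (\<lambda>e. f ` e) ` E \<longleftrightarrow> {v i, v j} \<in> E"
proof
  assume "{i, j} \<in> (\<lambda>e. f ` e) ` E"
  then obtain e where e: "e \<in> E" "f ` e = {i, j}" by auto
  then have "e \<subseteq> V"
    using assms(1) by (auto simp: all_pairs_def)
  then have "v ` f ` e = e"
    using assms(2) by (force simp: image_image)
  then have "e = {v i, v j}"
    using e(2) by simp
  then show "{v i, v j} \<in> E" using e(1) by simp
next
  assume "{v i, v j} \<in> E"
  moreover have "f ` {v i, v j} = {i, j}" using assms(3,4) by simp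
  ultimately show "{i, j} \<in> (\<lambda>e. f ` e) ` E" by (metis image_eqI)
qed

lemma (in type_A) compatible_relabelling_iff:
  assumes E: "E \<subseteq> all_pairs V" and f: "bij_betw f V {1..l}"
    and v: "\<And>x. x \<in> V \<Longrightarrow> v (f x) = x" "\<And>i. i \<in> {1..l} \<Longrightarrow> f (v i) = i"
  shows "worpitzky_compatible \<epsilon> l (graph_roots \<epsilon> ((\<lambda>e. f ` e) ` E)) \<longleftrightarrow>
    umbrella_free l (\<lambda>i j. {v i, v j} \<in> E)"
proof -
  let ?E = "(\<lambda>e. f ` e) ` E"
  have "?E \<subseteq> all_pairs {1..l}"
  proof
    fix e' assume "e' \<in> ?E"
    then obtain e where e: "e' = f ` e" "e \<subseteq> V" "card e = 2"
      using E by (auto simp: all_pairs_def)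
    have "inj_on f e"
      using f e(2) by (auto simp: bij_betw_def intro: inj_on_subset)
    then show "e' \<in> all_pairs {1..l}"
      using e f by (auto simp: all_pairs_def card_image bij_betw_def)
  qed
  then have "worpitzky_compatible \<epsilon> l (graph_roots \<epsilon> ?E) \<longleftrightarrow> umbrella_free l (\<lambda>i j. {i, j} \<in> ?E)"
    using umbrella_free_imp_compatible compatible_imp_umbrella_free by blast
  also have "\<dots> \<longleftrightarrow> umbrella_free l (\<lambda>i j. {v i, v j} \<in> E)"
  proof -
    have "{i, j} \<in> ?E \<longleftrightarrow> {v i, v j} \<in> E" if "1 \<le> i" "i < j" "j \<le> l" for i j
      using pair_mem_relabelled[where E = E and V = V and v = v and f = f] E v that by simp
    then show ?thesis
      unfolding umbrella_free_def by (smt (verit) le_trans less_imp_le less_trans)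
  qed
  finally show ?thesis .
qed

theorem theorem1p3:
  fixes V :: "'a set" and E :: "'a set set"
    and \<epsilon> :: "nat \<Rightarrow> real ^ 'n" and l :: nat
  assumes "finite_simple_graph V E"
    and "card V = l"
    and "CARD('n) = l"
    and "bij_betw \<epsilon> {1..l} Basis"
  shows "((\<exists>f. bij_betw f V {1..l} \<and>
             worpitzky_compatible \<epsilon> l (graph_roots \<epsilon> ((\<lambda>e. f ` e) ` E)))
          \<longleftrightarrow>
          (\<exists>v. bij_betw v {1..l} V \<and>
             (\<forall>i\<in>{1..l}. \<forall>j\<in>{1..l}. \<forall>m::nat. \<forall>p :: nat \<Rightarrow> nat.
                i < j \<and> {v i, v j} \<in> E \<and> 1 \<le> m \<and> strict_mono_on {1..m} p \<and> p 1 = i \<and> p m = j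
                \<longrightarrow> (\<exists>a. 1 \<le> a \<and> a < m \<and> {v (p a), v (p (a + 1))} \<in> E))))
       \<and> ((\<exists>v. bij_betw v {1..l} V \<and>
             (\<forall>i\<in>{1..l}. \<forall>j\<in>{1..l}. \<forall>m::nat. \<forall>p :: nat \<Rightarrow> nat.
                i < j \<and> {v i, v j} \<in> E \<and> 1 \<le> m \<and> strict_mono_on {1..m} p \<and> p 1 = i \<and> p m = j
                \<longrightarrow> (\<exists>a. 1 \<le> a \<and> a < m \<and> {v (p a), v (p (a + 1))} \<in> E)))
          \<longleftrightarrow>
          cocomparability_graph V E)"
proof -
  interpret type_A \<epsilon> l
    using assms(4) by unfold_locales
  have E: "E \<subseteq> all_pairs V"
    using assms(1) by (simp add: finite_simple_graph_def)
  \<comment> \<open>Labellings and orderings are inverse bijections, and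
    \<open>umbrella_free_iff_chains\<close> turns condition (ii) into umbrella-freeness.\<close>
  have "(\<exists>f. bij_betw f V {1..l} \<and> worpitzky_compatible \<epsilon> l (graph_roots \<epsilon> ((\<lambda>e. f ` e) ` E)))
    \<longleftrightarrow> (\<exists>v. bij_betw v {1..l} V \<and> umbrella_free l (\<lambda>i j. {v i, v j} \<in> E))"
  proof
    assume "\<exists>f. bij_betw f V {1..l} \<and> worpitzky_compatible \<epsilon> l (graph_roots \<epsilon> ((\<lambda>e. f ` e) ` E))"
    then obtain f where f: "bij_betw f V {1..l}"
      "worpitzky_compatible \<epsilon> l (graph_roots \<epsilon> ((\<lambda>e. f ` e) ` E))" by blast
    have "umbrella_free l (\<lambda>i j. {inv_into V f i, inv_into V f j} \<in> E)"
      using f compatible_relabelling_iff[OF E f(1), of "inv_into V f"]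
        bij_betw_inv_into_left[OF f(1)] bij_betw_inv_into_right[OF f(1)] by blast
    then show "\<exists>v. bij_betw v {1..l} V \<and> umbrella_free l (\<lambda>i j. {v i, v j} \<in> E)"
      using bij_betw_inv_into[OF f(1)] by blast
  next
    assume "\<exists>v. bij_betw v {1..l} V \<and> umbrella_free l (\<lambda>i j. {v i, v j} \<in> E)"
    then obtain v where v: "bij_betw v {1..l} V" "umbrella_free l (\<lambda>i j. {v i, v j} \<in> E)" by blast
    have f: "bij_betw (inv_into {1..l} v) V {1..l}"
      by (rule bij_betw_inv_into[OF v(1)])
    then have "worpitzky_compatible \<epsilon> l (graph_roots \<epsilon> ((\<lambda>e. inv_into {1..l} v ` e) ` E))"
      using v(2) compatible_relabelling_iff[OF E f, of v]
        bij_betw_inv_into_left[OF v(1)] bij_betw_inv_into_right[OF v(1)] by blast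
    then show "\<exists>f. bij_betw f V {1..l} \<and> worpitzky_compatible \<epsilon> l (graph_roots \<epsilon> ((\<lambda>e. f ` e) ` E))"
      using f by blast
  qed
  then show ?thesis
    using cocomparability_graph_iff_umbrella_free[OF assms(1)]
    unfolding umbrella_free_iff_chains assms(2) by blast
qed

end
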